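(* Let $Q$ be a quiver and let $C\subseteq \Bbbk Q$ be an admissible subcoalgebra of the path coalgebra $\Bbbk Q$. Then its tail closure $T(C)$ is a generator of the category of its left comodules.
   Context: $\Bbbk$ is a field. A quiver $Q$ has vertex set $Q_0$ and arrow set $Q_1$, each arrow $\alpha$ having a source $s(\alpha)$ and target $t(\alpha)$. Paths are the trivial paths (identified with the vertices) and finite sequences $\alpha_1\cdots\alpha_n$ of arrows with $t(\alpha_i)=s(\alpha_{i+1})$; concatenation $xy$ is defined when $t(x)=s(y)$, and is extended bilinearly. The path coalgebra $\Bbbk Q$ has basis all paths, with $\Delta(p)=\sum_{xy=p}x\otimes y$ and $\varepsilon(p)=1$ if $p$ is trivial, $0$ otherwise. A subcoalgebra $C\subseteq\Bbbk Q$ is admissible if it contains all vertices and arrows of $Q$. A right coideal of a coalgebra $D$ is a subspace $I$ with $\Delta(I)\subseteq I\otimes D$; for $x\in D$, $\langle x\rangle^D$ denotes the smallest right coideal of $D$ containing $x$. A multipath is a nonzero linear combination of paths all having the same source and the same target; $M(C)$ is the set of multipaths lying in $C$. A subset $F\subseteq M(C)$ is independent if it is linearly independent and $\langle x\rangle^C\cap F=\{x\}$ for all $x\in F$. Tail closure: for a subcoalgebra $C\subseteq \Bbbk Q$, let $\overline{Q}$ be the quiver obtained from $Q$ by adding, for each finite independent set $F=\{p_1,\dots,p_n\}\subseteq M(C)$ (with a fixed enumeration), a new vertex $e_F$ and $n$ new arrows $\alpha_{i,F}:t(p_i)\to e_F$; put $q_F=p_1\alpha_{1,F}+\cdots+p_n\alpha_{n,F}\in\Bbbk\overline{Q}$,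 and let $\overline{C}$ be the subcoalgebra of $\Bbbk\overline{Q}$ generated by $C$ and all such $q_F$. Set $T^0(Q)=Q$, $T^0(C)=C$, $T^{n+1}(Q)=\overline{T^n(Q)}$, $T^{n+1}(C)=\overline{T^n(C)}$; then $T(C)=\bigcup_n T^n(C)\subseteq\Bbbk T(Q)$ with $T(Q)=\bigcup_nT^n(Q)$. An object $G$ of a category with coproducts is a generator if for every object $X$ there is a set $I$ and an epimorphism $G^{(I)}\to X$. *)

theory Defs
  imports Main "HOL.Vector_Spaces"
begin

text \<open>
Conventions.  A quiver is given by a vertex set V :: 'v set, an arrow set A :: 'a set and
source/target maps s t :: 'a => 'v (with s, t mapping A into V).
A path is encoded as a pair (v, as) :: 'v * 'a list: the trivial path at v is (v, []),
and a nonempty path a1...an is (s a1, [a1,...,an]).  Elements of the path coalgebra kQ are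
finitely supported coefficient functions  'v * 'a list => 'k  supported on paths of Q.
An element of kQ (x) kQ is a finitely supported function on pairs of paths
(coefficient of x (x) y).
\<close>

type_synonym ('v,'a) path = "'v \<times> 'a list"
type_synonym ('v,'a,'k) lc = "('v,'a) path \<Rightarrow> 'k"

definition psrc :: "('v,'a) path \<Rightarrow> 'v" where
  "psrc p = fst p"

definition ptgt :: "('a \<Rightarrow> 'v) \<Rightarrow> ('v,'a) path \<Rightarrow> 'v" where
  "ptgt t p = (if snd p = [] then fst p else t (last (snd p)))"

definition pconcat :: "('v,'a) path \<Rightarrow> ('v,'a) path \<Rightarrow> ('v,'a) path" where
  "pconcat p q = (fst p, snd p @ snd q)"

definition is_quiver :: "('a \<Rightarrow> 'v) \<Rightarrow> ('a \<Rightarrow> 'v) \<Rightarrow> 'v set \<Rightarrow> 'a set \<Rightarrow> bool" where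
  "is_quiver s t V A \<longleftrightarrow> (\<forall>a\<in>A. s a \<in> V \<and> t a \<in> V)"

definition is_path :: "('a \<Rightarrow> 'v) \<Rightarrow> ('a \<Rightarrow> 'v) \<Rightarrow> 'v set \<Rightarrow> 'a set \<Rightarrow> ('v,'a) path \<Rightarrow> bool" where
  "is_path s t V A p \<longleftrightarrow> fst p \<in> V \<and> set (snd p) \<subseteq> A
     \<and> (snd p \<noteq> [] \<longrightarrow> s (hd (snd p)) = fst p)
     \<and> (\<forall>i. Suc i < length (snd p) \<longrightarrow> t (snd p ! i) = s (snd p ! Suc i))"

definition pbasis :: "('v,'a) path \<Rightarrow> ('v,'a,'k::field) lc" where
  "pbasis p = (\<lambda>q. if q = p then 1 else 0)"

definition path_coalg :: "('a \<Rightarrow> 'v) \<Rightarrow> ('a \<Rightarrow> 'v) \<Rightarrow> 'v set \<Rightarrow> 'a set \<Rightarrow> ('v,'a,'k::field) lc set" where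
  "path_coalg s t V A = {c. finite {p. c p \<noteq> 0} \<and> (\<forall>p. c p \<noteq> 0 \<longrightarrow> is_path s t V A p)}"

definition comult :: "('a \<Rightarrow> 'v) \<Rightarrow> ('v,'a,'k::field) lc \<Rightarrow> ('v,'a) path \<times> ('v,'a) path \<Rightarrow> 'k" where
  "comult t c = (\<lambda>(x,y). if ptgt t x = psrc y then c (pconcat x y) else 0)"

text \<open>Bilinear extension of concatenation (product in the path algebra).\<close>
definition cmul :: "('a \<Rightarrow> 'v) \<Rightarrow> ('v,'a,'k::field) lc \<Rightarrow> ('v,'a,'k) lc \<Rightarrow> ('v,'a,'k) lc" where
  "cmul t c d = (\<lambda>x. \<Sum>i\<in>{..length (snd x)}.
      c (fst x, take i (snd x)) * d (ptgt t (fst x, take i (snd x)), drop i (snd x)))"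

definition tens :: "('v,'a,'k::field) lc set \<Rightarrow> ('v,'a,'k) lc set
    \<Rightarrow> (('v,'a) path \<times> ('v,'a) path \<Rightarrow> 'k) set" where
  "tens X Y = {(\<lambda>(x,y). \<Sum>i<n. a i x * b i y) | (n::nat) a b. \<forall>i<n. a i \<in> X \<and> b i \<in> Y}"

definition ksubspace :: "('v,'a,'k::field) lc set \<Rightarrow> bool" where
  "ksubspace S \<longleftrightarrow> (\<lambda>_. 0) \<in> S \<and> (\<forall>x\<in>S. \<forall>y\<in>S. (\<lambda>p. x p + y p) \<in> S)
      \<and> (\<forall>a. \<forall>x\<in>S. (\<lambda>p. a * x p) \<in> S)"

definition subcoalg :: "('a \<Rightarrow> 'v) \<Rightarrow> ('a \<Rightarrow> 'v) \<Rightarrow> 'v set \<Rightarrow> 'a set \<Rightarrow> ('v,'a,'k::field) lc set \<Rightarrow> bool" where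
  "subcoalg s t V A C \<longleftrightarrow> ksubspace C \<and> C \<subseteq> path_coalg s t V A \<and> (\<forall>c\<in>C. comult t c \<in> tens C C)"

definition admissible :: "('a \<Rightarrow> 'v) \<Rightarrow> ('a \<Rightarrow> 'v) \<Rightarrow> 'v set \<Rightarrow> 'a set \<Rightarrow> ('v,'a,'k::field) lc set \<Rightarrow> bool" where
  "admissible s t V A C \<longleftrightarrow> subcoalg s t V A C
      \<and> (\<forall>v\<in>V. pbasis (v, []) \<in> C) \<and> (\<forall>a\<in>A. pbasis (s a, [a]) \<in> C)"

definition right_coideal :: "('a \<Rightarrow> 'v) \<Rightarrow> ('v,'a,'k::field) lc set \<Rightarrow> ('v,'a,'k) lc set \<Rightarrow> bool" where
  "right_coideal t D I \<longleftrightarrow> ksubspace I \<and> I \<subseteq> D \<and> (\<forall>x\<in>I. comult t x \<in> tens I D)"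

definition gen_rcoideal :: "('a \<Rightarrow> 'v) \<Rightarrow> ('v,'a,'k::field) lc set \<Rightarrow> ('v,'a,'k) lc \<Rightarrow> ('v,'a,'k) lc set" where
  "gen_rcoideal t D x = \<Inter>{I. right_coideal t D I \<and> x \<in> I}"

definition multipath :: "('a \<Rightarrow> 'v) \<Rightarrow> ('a \<Rightarrow> 'v) \<Rightarrow> 'v set \<Rightarrow> 'a set \<Rightarrow> ('v,'a,'k::field) lc \<Rightarrow> bool" where
  "multipath s t V A c \<longleftrightarrow> c \<in> path_coalg s t V A \<and> c \<noteq> (\<lambda>_. 0)
     \<and> (\<forall>p q. c p \<noteq> 0 \<longrightarrow> c q \<noteq> 0 \<longrightarrow> psrc p = psrc q \<and> ptgt t p = ptgt t q)"

definition multipaths :: "('a \<Rightarrow> 'v) \<Rightarrow> ('a \<Rightarrow> 'v) \<Rightarrow> 'v set \<Rightarrow> 'a set \<Rightarrow> ('v,'a,'k::field) lc set \<Rightarrow> ('v,'a,'k) lc set" where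
  "multipaths s t V A C = {c\<in>C. multipath s t V A c}"

definition mtgt :: "('a \<Rightarrow> 'v) \<Rightarrow> ('v,'a,'k::field) lc \<Rightarrow> 'v" where
  "mtgt t c = ptgt t (SOME p. c p \<noteq> 0)"

definition lin_indep :: "('v,'a,'k::field) lc set \<Rightarrow> bool" where
  "lin_indep F \<longleftrightarrow> (\<forall>S u. finite S \<and> S \<subseteq> F \<and> (\<forall>p. (\<Sum>f\<in>S. u f * f p) = 0) \<longrightarrow> (\<forall>f\<in>S. u f = 0))"

definition independent :: "('a \<Rightarrow> 'v) \<Rightarrow> ('a \<Rightarrow> 'v) \<Rightarrow> 'v set \<Rightarrow> 'a set \<Rightarrow> ('v,'a,'k::field) lc set
    \<Rightarrow> ('v,'a,'k) lc set \<Rightarrow> bool" where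
  "independent s t V A C F \<longleftrightarrow> F \<subseteq> multipaths s t V A C \<and> lin_indep F
     \<and> (\<forall>x\<in>F. gen_rcoideal t C x \<inter> F = {x})"

definition gen_subcoalg :: "('a \<Rightarrow> 'v) \<Rightarrow> ('a \<Rightarrow> 'v) \<Rightarrow> 'v set \<Rightarrow> 'a set \<Rightarrow> ('v,'a,'k::field) lc set
    \<Rightarrow> ('v,'a,'k) lc set" where
  "gen_subcoalg s t V A S = \<Inter>{D. subcoalg s t V A D \<and> S \<subseteq> D}"

text \<open>One step of the tail closure (Q, C) to (Qbar, Cbar), inside the ambient types 'v, 'a:
 for each finite independent F, a fresh vertex eV F, and for each p in F a fresh arrow
 eA F p : t(p) -> eV F (the arrows are indexed by the elements of F, which is the same as
 indexing them by a fixed enumeration of F); q_F = sum over p in F of p * eA F p.\<close>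
definition tail_step :: "('a \<Rightarrow> 'v) \<Rightarrow> ('a \<Rightarrow> 'v) \<Rightarrow> 'v set \<Rightarrow> 'a set \<Rightarrow> ('v,'a,'k::field) lc set
    \<Rightarrow> 'v set \<Rightarrow> 'a set \<Rightarrow> ('v,'a,'k) lc set \<Rightarrow> bool" where
  "tail_step s t V A C V' A' C' \<longleftrightarrow>
    (\<exists>(eV :: ('v,'a,'k) lc set \<Rightarrow> 'v) (eA :: ('v,'a,'k) lc set \<Rightarrow> ('v,'a,'k) lc \<Rightarrow> 'a).
      let FF = {F. finite F \<and> independent s t V A C F} in
        inj_on eV FF \<and> (\<forall>F\<in>FF. eV F \<notin> V)
      \<and> inj_on (\<lambda>(F,p). eA F p) (Sigma FF (\<lambda>F. F))
      \<and> (\<forall>F\<in>FF. \<forall>p\<in>F. eA F p \<notin> A \<and> s (eA F p) = mtgt t p \<and> t (eA F p) = eV F)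
      \<and> V' = V \<union> eV ` FF
      \<and> A' = A \<union> {eA F p | F p. F \<in> FF \<and> p \<in> F}
      \<and> C' = gen_subcoalg s t V' A'
              (C \<union> {(\<lambda>x. \<Sum>p\<in>F. cmul t p (pbasis (s (eA F p), [eA F p])) x) | F. F \<in> FF}))"

definition tail_closure :: "('a \<Rightarrow> 'v) \<Rightarrow> ('a \<Rightarrow> 'v) \<Rightarrow> 'v set \<Rightarrow> 'a set \<Rightarrow> ('v,'a,'k::field) lc set
    \<Rightarrow> 'v set \<Rightarrow> 'a set \<Rightarrow> ('v,'a,'k) lc set \<Rightarrow> bool" where
  "tail_closure s t V A C TV TA TC \<longleftrightarrow>
    (\<exists>Vn An Cn. Vn 0 = V \<and> An 0 = A \<and> Cn 0 = C
      \<and> (\<forall>n. tail_step s t (Vn n) (An n) (Cn n) (Vn (Suc n)) (An (Suc n)) (Cn (Suc n)))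
      \<and> TV = (\<Union>n. Vn n) \<and> TA = (\<Union>n. An n) \<and> TC = (\<Union>n. Cn n))"

text \<open>Left comodule over a subcoalgebra D of kQ: a k-vector space on the type 'm with
 scalar multiplication sc, and coaction rho(m) = sum_p p (x) rho p m
 (rho p m is the component of rho(m) at the basis path p).\<close>
definition lcomodule :: "('a \<Rightarrow> 'v) \<Rightarrow> ('v,'a,'k::field) lc set
    \<Rightarrow> ('k \<Rightarrow> 'm::ab_group_add \<Rightarrow> 'm) \<Rightarrow> (('v,'a) path \<Rightarrow> 'm \<Rightarrow> 'm) \<Rightarrow> bool" where
  "lcomodule t D sc \<rho> \<longleftrightarrow> vector_space sc
     \<and> (\<forall>p. Vector_Spaces.linear sc sc (\<rho> p))
     \<and> (\<forall>m. finite {p. \<rho> p m \<noteq> 0})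
     \<and> (\<forall>m. \<exists>(n::nat) c w. (\<forall>i<n. c i \<in> D) \<and> (\<forall>p. \<rho> p m = (\<Sum>i<n. sc (c i p) (w i))))
     \<and> (\<forall>m x y. \<rho> y (\<rho> x m) = (if ptgt t x = psrc y then \<rho> (pconcat x y) m else 0))
     \<and> (\<forall>m. (\<Sum>v\<in>{v. \<rho> (v, []) m \<noteq> 0}. \<rho> (v, []) m) = m)"

definition reg_coact :: "('a \<Rightarrow> 'v) \<Rightarrow> ('v,'a) path \<Rightarrow> ('v,'a,'k::field) lc \<Rightarrow> ('v,'a,'k) lc" where
  "reg_coact t x c = (\<lambda>y. if ptgt t x = psrc y then c (pconcat x y) else 0)"

definition dsum :: "('v,'a,'k::field) lc set \<Rightarrow> 'i set \<Rightarrow> ('i \<Rightarrow> ('v,'a,'k) lc) set" where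
  "dsum D I = {g. finite {i. g i \<noteq> (\<lambda>_. 0)} \<and> (\<forall>i\<in>I. g i \<in> D) \<and> (\<forall>i. i \<notin> I \<longrightarrow> g i = (\<lambda>_. 0))}"

definition comod_epi_from_sum :: "('a \<Rightarrow> 'v) \<Rightarrow> ('v,'a,'k::field) lc set \<Rightarrow> 'i set
    \<Rightarrow> ('k \<Rightarrow> 'm::ab_group_add \<Rightarrow> 'm) \<Rightarrow> (('v,'a) path \<Rightarrow> 'm \<Rightarrow> 'm)
    \<Rightarrow> (('i \<Rightarrow> ('v,'a,'k) lc) \<Rightarrow> 'm) \<Rightarrow> bool" where
  "comod_epi_from_sum t D I sc \<rho> f \<longleftrightarrow>
     (\<forall>g\<in>dsum D I. \<forall>h\<in>dsum D I. f (\<lambda>i p. g i p + h i p) = f g + f h)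
   \<and> (\<forall>a. \<forall>g\<in>dsum D I. f (\<lambda>i p. a * g i p) = sc a (f g))
   \<and> (\<forall>g\<in>dsum D I. \<forall>x. \<rho> x (f g) = f (\<lambda>i. reg_coact t x (g i)))
   \<and> f ` dsum D I = UNIV"

end

theory Submission
  imports Defs
begin

text \<open>
Let \<open>m\<close> be an element of a left comodule \<open>M\<close> supported at one source vertex. Its finitely many
coefficients lie in some stage \<open>C\<^sub>n\<close>; cut them into multipaths and choose a set \<open>F\<close> of multipaths, of
minimal cardinality, whose right coideal contains them all. Minimality makes \<open>F\<close> independent, so stage
\<open>n + 1\<close> has a vertex \<open>e\<^sub>F\<close> and an element \<open>q\<^sub>F\<close>. A combination of prefix strips that annihilates \<open>q\<^sub>F\<close>
annihilates \<open>F\<close>, hence the coefficients of \<open>m\<close>, hence \<open>m\<close>; so the left coideal generated by \<open>q\<^sub>F\<close> maps to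
\<open>M\<close> with \<open>q\<^sub>F \<mapsto> m\<close>. This left coideal is exactly the span of the elements of \<open>T(C)\<close> ending in \<open>e\<^sub>F\<close>, a
direct summand of \<open>T(C)\<close>, so the map extends to \<open>T(C)\<close> by zero.
\<close>

section \<open>Tensors and slices\<close>

lemma ksubspaceD:
  assumes "ksubspace S"
  shows "(\<lambda>_. 0) \<in> S" "x \<in> S \<Longrightarrow> y \<in> S \<Longrightarrow> (\<lambda>p. x p + y p) \<in> S" "x \<in> S \<Longrightarrow> (\<lambda>p. a * x p) \<in> S"
  using assms unfolding ksubspace_def by auto

lemma ksubspace_diff:
  assumes S: "ksubspace S" and "x \<in> S" "y \<in> S"
  shows "(\<lambda>p. x p - y p) \<in> S"
  using ksubspaceD(2)[OF S \<open>x \<in> S\<close> ksubspaceD(3)[OF S \<open>y \<in> S\<close>, of "-1"]] by simp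

lemma ksubspace_sum:
  assumes S: "ksubspace S" and "finite X" "\<And>i. i \<in> X \<Longrightarrow> f i \<in> S"
  shows "(\<lambda>p. \<Sum>i\<in>X. u i * f i p) \<in> S"
  using assms(2,3)
proof (induction X rule: finite_induct)
  case empty
  then show ?case using ksubspaceD(1)[OF S] by simp
next
  case (insert j X)
  have "(\<lambda>p. u j * f j p + (\<Sum>i\<in>X. u i * f i p)) \<in> S"
    using insert by (intro ksubspaceD(2)[OF S] ksubspaceD(3)[OF S]) auto
  then show ?case using insert by simp
qed

lemma tensE:
  assumes "T \<in> tens X Y"
  obtains n :: nat and a b where "T = (\<lambda>(x,y). \<Sum>i<n. a i x * b i y)" "\<forall>i<n. a i \<in> X \<and> b i \<in> Y"
  using assms unfolding tens_def by blast

lemma tens_add_pure: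
  assumes "T \<in> tens X Y" "u \<in> X" "v \<in> Y"
  shows "(\<lambda>(x,y). T (x,y) + u x * v y) \<in> tens X Y"
proof -
  obtain n :: nat and a b where T: "T = (\<lambda>(x,y). \<Sum>i<n. a i x * b i y)" and ab: "\<forall>i<n. a i \<in> X \<and> b i \<in> Y"
    using assms(1) by (rule tensE)
  define a' where "a' = a(n := u)"
  define b' where "b' = b(n := v)"
  have "(\<lambda>(x,y). T (x,y) + u x * v y) = (\<lambda>(x,y). \<Sum>i<Suc n. a' i x * b' i y)"
    by (auto simp: T a'_def b'_def fun_eq_iff)
  moreover have "\<forall>i<Suc n. a' i \<in> X \<and> b' i \<in> Y"
    using ab assms(2,3) by (auto simp: a'_def b'_def less_Suc_eq)
  ultimately show ?thesis unfolding tens_def by blast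
qed

lemma tens_swap: "T \<in> tens X Y \<Longrightarrow> (\<lambda>(x,y). T (y,x)) \<in> tens Y X"
proof -
  assume "T \<in> tens X Y"
  then obtain n :: nat and a b where T: "T = (\<lambda>(x,y). \<Sum>i<n. a i x * b i y)" and ab: "\<forall>i<n. a i \<in> X \<and> b i \<in> Y"
    by (rule tensE)
  have "(\<lambda>(x,y). T (y,x)) = (\<lambda>(x,y). \<Sum>i<n. b i x * a i y)"
    by (simp add: T mult.commute)
  then show ?thesis using ab unfolding tens_def by blast
qed

text \<open>Fixing \<open>y\<close> turns the tensor into a combination of the left factors
  \<open>a i\<close> with scalars \<open>b i y\<close>.\<close>

lemma tens_slice_left:
  assumes "ksubspace X" "T \<in> tens X Y"
  shows "(\<lambda>x. T (x,y)) \<in> X"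
proof -
  obtain n :: nat and a b where T: "T = (\<lambda>(x,y). \<Sum>i<n. a i x * b i y)" and ab: "\<forall>i<n. a i \<in> X \<and> b i \<in> Y"
    using assms(2) by (rule tensE)
  have "(\<lambda>x. \<Sum>i<n. b i y * a i x) \<in> X"
    using ab by (intro ksubspace_sum[OF assms(1)]) auto
  then show ?thesis by (simp add: T mult.commute)
qed

lemma tens_slice_right:
  assumes "ksubspace Y" "T \<in> tens X Y"
  shows "(\<lambda>y. T (x,y)) \<in> Y"
  using tens_slice_left[OF assms(1) tens_swap[OF assms(2)], of x] by simp

text \<open>Gaussian elimination on the right-hand tensor factors.\<close>

lemma tens_of_slices_left_aux:
  fixes n :: nat
  assumes I: "ksubspace I" and D: "ksubspace D"
  shows "\<lbrakk>T = (\<lambda>(x,y). \<Sum>i<n. a i x * b i y); \<forall>i<n. b i \<in> D; \<forall>y. (\<lambda>x. T (x,y)) \<in> I\<rbrakk> \<Longrightarrow> T \<in> tens I D"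
proof (induction n arbitrary: T b)
  case 0
  then show ?case unfolding tens_def by (auto intro!: exI[of _ "0::nat"])
next
  case (Suc n)
  show ?case
  proof (cases "\<exists>y0. b n y0 \<noteq> 0")
    case False
    then show ?thesis using Suc.prems by (intro Suc.IH[of _ b]) (auto simp: fun_eq_iff)
  next
    case True
    then obtain y0 where y0: "b n y0 \<noteq> 0" by blast
    \<comment> \<open>\<open>y0\<close> is the pivot: \<open>\<sigma>\<close> lies in
      \<open>I\<close> as a slice of \<open>T\<close>, and \<open>\<beta> y0 = 1\<close>, so
      subtracting the pure tensor of \<open>\<sigma>\<close> and \<open>\<beta>\<close> absorbs the
      last summand and leaves \<open>n\<close> summands.\<close>
    define \<sigma> where "\<sigma> = (\<lambda>x. T (x,y0))"
    define \<beta> where "\<beta> = (\<lambda>y. inverse (b n y0) * b n y)"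
    define b' where "b' = (\<lambda>i y. b i y - (b i y0 * inverse (b n y0)) * b n y)"
    define T' where "T' = (\<lambda>(x,y). T (x,y) - \<sigma> x * \<beta> y)"
    have sI: "\<sigma> \<in> I" unfolding \<sigma>_def using Suc.prems(3) by (rule spec)
    have bD: "\<beta> \<in> D" unfolding \<beta>_def using Suc.prems(2) by (intro ksubspaceD(3)[OF D]) simp
    have "T' \<in> tens I D"
    proof (rule Suc.IH[of _ b'])
      have "T' (x,y) = (\<Sum>i<n. a i x * b' i y)" for x y
      proof -
        have "T' (x,y) = (\<Sum>i<n. a i x * b i y) + a n x * b n y
              - (\<Sum>i<n. a i x * b i y0) * \<beta> y - a n x * b n y0 * \<beta> y"
          by (simp add: T'_def \<sigma>_def Suc.prems(1) algebra_simps)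
        also have "a n x * b n y0 * \<beta> y = a n x * b n y" using y0 by (simp add: \<beta>_def)
        also have "(\<Sum>i<n. a i x * b i y) + a n x * b n y
              - (\<Sum>i<n. a i x * b i y0) * \<beta> y - a n x * b n y = (\<Sum>i<n. a i x * b' i y)"
          by (simp add: b'_def \<beta>_def sum_distrib_left sum_distrib_right sum_subtractf algebra_simps)
        finally show ?thesis .
      qed
      then show "T' = (\<lambda>(x,y). \<Sum>i<n. a i x * b' i y)" by auto
      show "\<forall>i<n. b' i \<in> D" unfolding b'_def using Suc.prems(2)
        by (intro allI impI ksubspace_diff[OF D] ksubspaceD(3)[OF D]) auto
      show "\<forall>y. (\<lambda>x. T' (x,y)) \<in> I"
      proof
        fix y
        have "(\<lambda>x. T (x,y) - \<beta> y * \<sigma> x) \<in> I"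
          by (intro ksubspace_diff[OF I] ksubspaceD(3)[OF I] sI spec[OF Suc.prems(3)])
        then show "(\<lambda>x. T' (x,y)) \<in> I" by (simp add: T'_def mult.commute)
      qed
    qed
    from tens_add_pure[OF this sI bD] show ?thesis by (simp add: T'_def)
  qed
qed

text \<open>Converse of \<open>tens_slice_left\<close> for finite tensors. It turns conditions on
  comultiplication into closure under the strips below.\<close>

lemma tens_of_slices_left:
  assumes "ksubspace I" "ksubspace D" "T \<in> tens X D" "\<And>y. (\<lambda>x. T (x,y)) \<in> I"
  shows "T \<in> tens I D"
proof -
  obtain n :: nat and a b where T: "T = (\<lambda>(x,y). \<Sum>i<n. a i x * b i y)" and ab: "\<forall>i<n. a i \<in> X \<and> b i \<in> D"
    using assms(3) by (rule tensE)
  then show ?thesis using tens_of_slices_left_aux[OF assms(1,2) T] assms(4) by (simp add: T)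
qed

lemma tens_of_slices_right:
  assumes "ksubspace I" "ksubspace D" "T \<in> tens D X" "\<And>x. (\<lambda>y. T (x,y)) \<in> I"
  shows "T \<in> tens D I"
  using tens_swap[OF tens_of_slices_left[OF assms(1,2) tens_swap[OF assms(3)]]] assms(4) by simp

section \<open>Stripping prefixes and suffixes\<close>

text \<open>Contraction of the right leg of the comultiplication with the dual basis vector of
  \<open>y\<close>; \<open>reg_coact\<close> is its mirror image, contracting the left leg.\<close>

definition rstrip :: "('a \<Rightarrow> 'v) \<Rightarrow> ('v,'a) path \<Rightarrow> ('v,'a,'k::field) lc \<Rightarrow> ('v,'a,'k) lc" where
  "rstrip t y c = (\<lambda>x. if ptgt t x = psrc y then c (pconcat x y) else 0)"

lemma pconcat_assoc: "pconcat (pconcat x y) z = pconcat x (pconcat y z)"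
  by (simp add: pconcat_def)

lemma psrc_pconcat [simp]: "psrc (pconcat x y) = psrc x"
  by (simp add: pconcat_def psrc_def)

lemma ptgt_pconcat: "ptgt t x = psrc y \<Longrightarrow> ptgt t (pconcat x y) = ptgt t y"
  by (auto simp: pconcat_def psrc_def ptgt_def)

lemma ptgt_trivial [simp]: "ptgt t (w, []) = w" and psrc_trivial [simp]: "psrc (w, []) = w"
  by (simp_all add: ptgt_def psrc_def)

lemma pconcat_trivial_right [simp]: "pconcat x (w, []) = x"
  by (simp add: pconcat_def)

lemma pconcat_trivial_left: "psrc x = w \<Longrightarrow> pconcat (w, []) x = x"
  by (cases x) (simp add: pconcat_def psrc_def)

lemma rstrip_trivial: "rstrip t (w, []) c = (\<lambda>x. if ptgt t x = w then c x else 0)"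
  by (auto simp: rstrip_def)

lemma rstrip_zero [simp]: "rstrip t y (\<lambda>_. 0) = (\<lambda>_. 0)"
  and reg_coact_zero [simp]: "reg_coact t y (\<lambda>_. 0) = (\<lambda>_. 0)"
  by (simp_all add: rstrip_def reg_coact_def)

lemma rstrip_add: "rstrip t y (\<lambda>p. c p + d p) = (\<lambda>p. rstrip t y c p + rstrip t y d p)"
  and reg_coact_add: "reg_coact t y (\<lambda>p. c p + d p) = (\<lambda>p. reg_coact t y c p + reg_coact t y d p)"
  by (auto simp: rstrip_def reg_coact_def)

lemma rstrip_scale: "rstrip t y (\<lambda>p. a * c p) = (\<lambda>p. a * rstrip t y c p)"
  and reg_coact_scale: "reg_coact t y (\<lambda>p. a * c p) = (\<lambda>p. a * reg_coact t y c p)"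
  by (auto simp: rstrip_def reg_coact_def)

text \<open>Coassociativity in coordinates: a prefix and a suffix are removed from opposite ends of
  a path.\<close>

lemma rstrip_reg_coact: "rstrip t y (reg_coact t x c) = reg_coact t x (rstrip t y c)"
  by (auto simp: rstrip_def reg_coact_def pconcat_assoc ptgt_pconcat fun_eq_iff)

lemma reg_coact_reg_coact:
  "reg_coact t y (reg_coact t x c) = (if ptgt t x = psrc y then reg_coact t (pconcat x y) c else (\<lambda>_. 0))"
  by (auto simp: reg_coact_def pconcat_assoc ptgt_pconcat fun_eq_iff)

text \<open>Only paths ending where \<open>y\<close> ends can have \<open>y\<close> as a suffix.
  This reduces suffix strips to the component of \<open>c\<close> at a single target.\<close>

lemma rstrip_rstrip_tgt: "rstrip t y (rstrip t (ptgt t y, []) c) = rstrip t y c"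
  by (auto simp: rstrip_def ptgt_pconcat fun_eq_iff)

lemma rstrip_tgt_tgt: "rstrip t (u, []) (rstrip t (w, []) c) = (if u = w then rstrip t (w, []) c else (\<lambda>_. 0))"
  by (auto simp: rstrip_trivial)

section \<open>Comultiplication and subcoalgebras in terms of strips\<close>

lemma comult_slices:
  "(\<lambda>x. comult t c (x,y)) = rstrip t y c" "(\<lambda>y. comult t c (x,y)) = reg_coact t x c"
  by (auto simp: comult_def rstrip_def reg_coact_def)

text \<open>Finitely many paths have finitely many suffixes; with \<open>Y\<close> the set of these,
  the comultiplication of \<open>c\<close> is the sum over \<open>z\<close> in \<open>Y\<close> of
  \<open>rstrip t z c\<close> \<otimes> \<open>z\<close>.\<close>

lemma comult_tens_UNIV:
  assumes "finite {p. c p \<noteq> 0}"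
  shows "comult t c \<in> tens UNIV UNIV"
proof -
  define Y where "Y = (\<Union>p\<in>{p. c p \<noteq> 0}. \<Union>i\<in>{..length (snd p)}. {(ptgt t (fst p, take i (snd p)), drop i (snd p))})"
  have Yfin: "finite Y" using assms by (auto simp: Y_def)
  have Y: "y \<in> Y" if "comult t c (x,y) \<noteq> 0" for x y
  proof -
    from that have 1: "ptgt t x = psrc y" and 2: "c (pconcat x y) \<noteq> 0"
      by (auto simp: comult_def split: if_splits)
    have "y = (ptgt t (fst (pconcat x y), take (length (snd x)) (snd (pconcat x y))), drop (length (snd x)) (snd (pconcat x y)))"
      using 1 by (cases x; cases y) (simp add: pconcat_def psrc_def)
    moreover have "length (snd x) \<le> length (snd (pconcat x y))" by (simp add: pconcat_def)
    ultimately show ?thesis unfolding Y_def using 2 by blast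
  qed
  have "(\<lambda>(x,y). \<Sum>z\<in>Z. rstrip t z c x * pbasis z y) \<in> tens UNIV UNIV" if "finite Z" for Z
    using that
  proof (induction Z rule: finite_induct)
    case empty
    then show ?case unfolding tens_def by (auto intro!: exI[of _ "0::nat"])
  next
    case (insert z Z)
    from tens_add_pure[OF insert.IH, of "rstrip t z c" "pbasis z"] insert.hyps
    show ?case by (simp add: add.commute)
  qed
  from this[OF Yfin] have "(\<lambda>(x,y). \<Sum>z\<in>Y. rstrip t z c x * pbasis z y) \<in> tens UNIV UNIV" .
  moreover have "comult t c (x,y) = (\<Sum>z\<in>Y. rstrip t z c x * pbasis z y)" for x y
  proof -
    have "(\<Sum>z\<in>Y. rstrip t z c x * pbasis z y) = (\<Sum>z\<in>Y. if y = z then rstrip t z c x else 0)"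
      by (intro sum.cong) (auto simp: pbasis_def)
    also have "\<dots> = (if y \<in> Y then rstrip t y c x else 0)" using Yfin by simp
    also have "\<dots> = comult t c (x,y)" using Y[of x y] fun_cong[OF comult_slices(1)[of t c y], of x] by auto
    finally show ?thesis by simp
  qed
  then have "comult t c = (\<lambda>(x,y). \<Sum>z\<in>Y. rstrip t z c x * pbasis z y)" by auto
  ultimately show ?thesis by simp
qed

lemma ksubspace_UNIV: "ksubspace UNIV" by (simp add: ksubspace_def)

text \<open>The strips are the slices of the comultiplication. For the converse, start from a finite
  tensor without constraints, move its left leg into \<open>C\<close> by suffix strips, then its
  right leg by prefix strips.\<close>

lemma subcoalg_iff_strips:
  "subcoalg s t V A C \<longleftrightarrow> ksubspace C \<and> C \<subseteq> path_coalg s t V A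
     \<and> (\<forall>c\<in>C. \<forall>x. reg_coact t x c \<in> C) \<and> (\<forall>c\<in>C. \<forall>y. rstrip t y c \<in> C)"
proof (intro iffI conjI ballI allI)
  assume *: "subcoalg s t V A C"
  then show C: "ksubspace C" "C \<subseteq> path_coalg s t V A" by (auto simp: subcoalg_def)
  fix c assume "c \<in> C"
  with * have ct: "comult t c \<in> tens C C" by (simp add: subcoalg_def)
  show "reg_coact t x c \<in> C" for x using tens_slice_right[OF C(1) ct, of x] by (simp add: comult_slices)
  show "rstrip t x c \<in> C" for x using tens_slice_left[OF C(1) ct, of x] by (simp add: comult_slices)
next
  assume *: "ksubspace C \<and> C \<subseteq> path_coalg s t V A
     \<and> (\<forall>c\<in>C. \<forall>x. reg_coact t x c \<in> C) \<and> (\<forall>c\<in>C. \<forall>y. rstrip t y c \<in> C)"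
  then have C: "ksubspace C" and strips: "reg_coact t x c \<in> C" "rstrip t x c \<in> C" if "c \<in> C" for c x
    using that by blast+
  have "comult t c \<in> tens C C" if c: "c \<in> C" for c
  proof -
    have "finite {p. c p \<noteq> 0}" using * c by (auto simp: path_coalg_def)
    then have "comult t c \<in> tens C UNIV"
      by (intro tens_of_slices_left[OF C[OF c] ksubspace_UNIV comult_tens_UNIV])
        (simp_all only: comult_slices strips c)
    then show ?thesis
      by (intro tens_of_slices_right[OF C[OF c] C[OF c]]) (simp_all only: comult_slices strips c)
  qed
  then show "subcoalg s t V A C" using * unfolding subcoalg_def by blast
qed

lemma subcoalgD:
  assumes "subcoalg s t V A C"
  shows "ksubspace C" "C \<subseteq> path_coalg s t V A"
    and "c \<in> C \<Longrightarrow> reg_coact t x c \<in> C" "c \<in> C \<Longrightarrow> rstrip t x c \<in> C"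
proof -
  note * = assms[unfolded subcoalg_iff_strips]
  show "ksubspace C" by (rule conjunct1[OF *])
  show "C \<subseteq> path_coalg s t V A" by (rule conjunct1[OF conjunct2[OF *]])
  show "reg_coact t x c \<in> C" if "c \<in> C"
    by (rule conjunct1[OF conjunct2[OF conjunct2[OF *]], THEN bspec, OF that, THEN spec])
  show "rstrip t x c \<in> C" if "c \<in> C"
    by (rule conjunct2[OF conjunct2[OF conjunct2[OF *]], THEN bspec, OF that, THEN spec])
qed

text \<open>The right leg already lies in the subcoalgebra \<open>D\<close>, so only the left leg,
  that is the suffix strips, has to be moved into \<open>I\<close>.\<close>

lemma right_coidealI:
  assumes "subcoalg s t V A D" "ksubspace I" "I \<subseteq> D" "\<And>c y. c \<in> I \<Longrightarrow> rstrip t y c \<in> I"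
  shows "right_coideal t D I"
proof -
  have D: "ksubspace D" "\<And>c. c \<in> D \<Longrightarrow> comult t c \<in> tens D D"
    using assms(1) unfolding subcoalg_def by blast+
  have "comult t c \<in> tens I D" if c: "c \<in> I" for c
    by (rule tens_of_slices_left[OF assms(2) D(1) D(2)])
      (use assms(3,4) c in \<open>auto simp only: comult_slices\<close>)
  then show ?thesis using assms(2,3) unfolding right_coideal_def by blast
qed

section \<open>Linear combinations of prefix strips\<close>

text \<open>The list \<open>L\<close> is a formal combination of paths, acting on coefficient
  functions here and on a comodule in \<open>mcomb\<close>. Repetitions are allowed, so that
  addition is just appending lists.\<close>

definition lcomb :: "('a \<Rightarrow> 'v) \<Rightarrow> ('k \<times> ('v,'a) path) list \<Rightarrow> ('v,'a,'k::field) lc \<Rightarrow> ('v,'a,'k) lc" where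
  "lcomb t L c = (\<lambda>y. \<Sum>(a,x)\<leftarrow>L. a * reg_coact t x c y)"

definition mcomb :: "('k \<Rightarrow> 'm \<Rightarrow> 'm) \<Rightarrow> (('v,'a) path \<Rightarrow> 'm \<Rightarrow> 'm) \<Rightarrow> ('k \<times> ('v,'a) path) list
    \<Rightarrow> 'm::ab_group_add \<Rightarrow> 'm" where
  "mcomb sc \<rho> L m = (\<Sum>(a,x)\<leftarrow>L. sc a (\<rho> x m))"

abbreviation lscale :: "'k::field \<Rightarrow> ('k \<times> 'p) list \<Rightarrow> ('k \<times> 'p) list" where
  "lscale b L \<equiv> map (\<lambda>(a,x). (b * a, x)) L"

text \<open>Right multiplication of the formal combination by the path \<open>y\<close>, where
  products of non-composable paths are dropped because they are zero.\<close>

definition lact :: "('a \<Rightarrow> 'v) \<Rightarrow> ('v,'a) path \<Rightarrow> ('k \<times> ('v,'a) path) list \<Rightarrow> ('k \<times> ('v,'a) path) list" where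
  "lact t y L = map (\<lambda>(a,x). (a, pconcat x y)) (filter (\<lambda>(a,x). ptgt t x = psrc y) L)"

lemma lcomb_Nil [simp]: "lcomb t [] c = (\<lambda>_. 0)"
  and lcomb_Cons: "lcomb t ((a,x) # L) c = (\<lambda>y. a * reg_coact t x c y + lcomb t L c y)"
  and lcomb_append: "lcomb t (L @ L') c = (\<lambda>y. lcomb t L c y + lcomb t L' c y)"
  by (simp_all add: lcomb_def)

lemma mcomb_Nil [simp]: "mcomb sc \<rho> [] m = 0"
  and mcomb_Cons: "mcomb sc \<rho> ((a,x) # L) m = sc a (\<rho> x m) + mcomb sc \<rho> L m"
  and mcomb_append: "mcomb sc \<rho> (L @ L') m = mcomb sc \<rho> L m + mcomb sc \<rho> L' m"
  by (simp_all add: mcomb_def)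

lemma lcomb_lscale: "lcomb t (lscale b L) c = (\<lambda>y. b * lcomb t L c y)"
  by (induction L) (auto simp: lcomb_Cons algebra_simps)

text \<open>Hence the combinations of prefix strips of \<open>c\<close> form a left coideal.
  \<open>mcomb_lact\<close> uses the same list, which is what makes the later map colinear.\<close>

lemma lcomb_lact: "reg_coact t y (lcomb t L c) = lcomb t (lact t y L) c"
  by (induction L)
    (auto simp: lcomb_Cons lact_def reg_coact_add reg_coact_scale reg_coact_reg_coact)

lemma rstrip_lcomb: "rstrip t y (lcomb t L c) = lcomb t L (rstrip t y c)"
  by (induction L) (auto simp: lcomb_Cons rstrip_add rstrip_scale rstrip_reg_coact)

lemma lcomb_zero [simp]: "lcomb t L (\<lambda>_. 0) = (\<lambda>_. 0)"
  by (induction L) (auto simp: lcomb_Cons)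

lemma lcomb_add: "lcomb t L (\<lambda>p. c p + d p) = (\<lambda>p. lcomb t L c p + lcomb t L d p)"
  by (induction L) (auto simp: lcomb_Cons reg_coact_add algebra_simps)

lemma lcomb_scale: "lcomb t L (\<lambda>p. a * c p) = (\<lambda>p. a * lcomb t L c p)"
  by (induction L) (auto simp: lcomb_Cons reg_coact_scale algebra_simps)

lemma lcomb_mem:
  assumes "ksubspace S" "\<And>x. reg_coact t x c \<in> S"
  shows "lcomb t L c \<in> S"
  using assms(2)
  by (induction L)
    (auto simp: lcomb_Cons intro!: ksubspaceD(1)[OF assms(1)] ksubspaceD(2)[OF assms(1)] ksubspaceD(3)[OF assms(1)])

lemma ksubspace_lcombs: "ksubspace {lcomb t L q | L. True}"
  unfolding ksubspace_def
proof (intro conjI ballI allI)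
  show "(\<lambda>_. 0) \<in> {lcomb t L q | L. True}" by (auto intro: exI[of _ "[]"])
next
  fix x y assume "x \<in> {lcomb t L q | L. True}" "y \<in> {lcomb t L q | L. True}"
  then obtain L L' where "x = lcomb t L q" "y = lcomb t L' q" by blast
  then show "(\<lambda>p. x p + y p) \<in> {lcomb t L q | L. True}"
    by (auto simp: lcomb_append intro!: exI[of _ "L @ L'"])
next
  fix a x assume "x \<in> {lcomb t L q | L. True}"
  then obtain L where "x = lcomb t L q" by blast
  then show "(\<lambda>p. a * x p) \<in> {lcomb t L q | L. True}"
    by (auto simp: lcomb_lscale intro!: exI[of _ "lscale a L"])
qed

text \<open>Counit property: stripping the trivial path at each source in the support splits
  \<open>c\<close> by source, and these pieces add up to \<open>c\<close>.\<close>

lemma ex_lcomb_self: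
  assumes "finite {p. c p \<noteq> 0}"
  shows "\<exists>L. lcomb t L c = c"
proof -
  have "finite (psrc ` {p. c p \<noteq> 0})" using assms by simp
  from finite_distinct_list[OF this] obtain vs where vs: "set vs = psrc ` {p. c p \<noteq> 0}" "distinct vs"
    by (elim exE conjE)
  have "lcomb t (map (\<lambda>v. (1, (v, []))) vs) c y = c y" for y
  proof -
    have "lcomb t (map (\<lambda>v. (1, (v, []))) vs) c y = (\<Sum>v\<leftarrow>vs. reg_coact t (v, []) c y)"
      by (simp add: lcomb_def comp_def)
    also have "\<dots> = (\<Sum>v\<in>set vs. reg_coact t (v, []) c y)"
      using vs(2) by (rule sum_list_distinct_conv_sum_set)
    also have "\<dots> = (\<Sum>v\<in>set vs. if v = psrc y then c y else 0)"
      by (intro sum.cong refl) (simp add: reg_coact_def pconcat_trivial_left)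
    also have "\<dots> = (if psrc y \<in> set vs then c y else 0)" by simp
    also have "\<dots> = c y" using vs(1) by (cases "c y = 0") simp_all
    finally show ?thesis .
  qed
  then have "lcomb t (map (\<lambda>v. (1, (v, []))) vs) c = c" by (rule ext)
  then show ?thesis by (rule exI)
qed

text \<open>Evaluating at all trivial paths recovers the pairing of \<open>L\<close> with \<open>c\<close>.\<close>

lemma lcomb_zero_pairing:
  assumes "lcomb t L c = (\<lambda>_. 0)"
  shows "(\<Sum>(a,x)\<leftarrow>L. a * c x) = 0"
proof -
  \<comment> \<open>\<open>W\<close> holds all targets of paths in \<open>L\<close>; the strip by
    \<open>x\<close> has a nonzero coefficient on trivial paths at most at \<open>ptgt t x\<close>,
    where it equals \<open>c x\<close>.\<close>
  define W where "W = (\<lambda>(a,x). ptgt t x) ` set L"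
  have W: "finite W" by (simp add: W_def)
  have "(\<Sum>w\<in>W. lcomb t K c (w, [])) = (\<Sum>(a,x)\<leftarrow>K. a * c x)" if "(\<lambda>(a,x). ptgt t x) ` set K \<subseteq> W" for K
    using that
  proof (induction K)
    case (Cons k K)
    obtain a x where k: "k = (a,x)" by (cases k)
    have "(\<Sum>w\<in>W. a * reg_coact t x c (w, [])) = (\<Sum>w\<in>W. if w = ptgt t x then a * c x else 0)"
      by (intro sum.cong) (auto simp: reg_coact_def)
    also have "\<dots> = a * c x" using W Cons.prems by (simp add: k)
    finally show ?case using Cons by (simp add: k lcomb_Cons sum.distrib)
  qed simp
  from this[of L] show ?thesis using assms by (simp add: W_def)
qed

section \<open>Path coalgebras\<close>

lemma is_path_successively:
  "is_path s t V A p \<longleftrightarrow> fst p \<in> V \<and> set (snd p) \<subseteq> A \<and> (snd p \<noteq> [] \<longrightarrow> s (hd (snd p)) = fst p)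
     \<and> successively (\<lambda>a b. t a = s b) (snd p)"
  by (auto simp: is_path_def successively_conv_nth)

lemma is_path_ptgt: "is_quiver s t V A \<Longrightarrow> is_path s t V A p \<Longrightarrow> ptgt t p \<in> V"
  by (auto simp: is_path_def is_quiver_def ptgt_def) (meson last_in_set subsetD)

lemma is_path_pconcat_iff:
  assumes "is_quiver s t V A" "ptgt t x = psrc y"
  shows "is_path s t V A (pconcat x y) \<longleftrightarrow> is_path s t V A x \<and> is_path s t V A y"
proof -
  have "is_path s t V A x \<Longrightarrow> psrc y \<in> V" using is_path_ptgt[OF assms(1), of x] assms(2) by simp
  then show ?thesis using assms(2)
    by (cases "snd x = []"; cases "snd y = []")
      (auto simp: is_path_successively pconcat_def ptgt_def psrc_def successively_append_iff)
qed

lemma is_path_mono: "is_path s t V A p \<Longrightarrow> V \<subseteq> V' \<Longrightarrow> A \<subseteq> A' \<Longrightarrow> is_path s t V' A' p"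
  by (auto simp: is_path_def)

lemma path_coalg_mono: "V \<subseteq> V' \<Longrightarrow> A \<subseteq> A' \<Longrightarrow> path_coalg s t V A \<subseteq> path_coalg s t V' A'"
  unfolding path_coalg_def using is_path_mono[of s t V A _ V' A'] by blast

lemma finite_support_strips:
  assumes "finite {p. c p \<noteq> 0}"
  shows "finite {p. rstrip t y c p \<noteq> 0}" "finite {p. reg_coact t y c p \<noteq> 0}"
proof -
  have "finite ((\<lambda>x. pconcat x y) -` {p. c p \<noteq> 0})"
    using assms by (rule finite_vimageI) (auto simp: inj_def pconcat_def prod_eq_iff)
  then show "finite {p. rstrip t y c p \<noteq> 0}"
    by (rule rev_finite_subset) (auto simp: rstrip_def split: if_splits)
  \<comment> \<open>\<open>pconcat y\<close> forgets the source of its second argument, so it is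
    injective only once that source is fixed.\<close>
  have "finite (pconcat y -` {p. c p \<noteq> 0} \<inter> {x. psrc x = ptgt t y})"
    using assms by (rule finite_vimage_IntI) (auto simp: inj_on_def pconcat_def psrc_def prod_eq_iff)
  then show "finite {p. reg_coact t y c p \<noteq> 0}"
    by (rule rev_finite_subset) (auto simp: reg_coact_def split: if_splits)
qed

lemma path_coalg_strips:
  assumes "is_quiver s t V A" "c \<in> path_coalg s t V A"
  shows "rstrip t y c \<in> path_coalg s t V A" "reg_coact t y c \<in> path_coalg s t V A"
proof -
  have fin: "finite {p. c p \<noteq> 0}" and path: "\<And>p. c p \<noteq> 0 \<Longrightarrow> is_path s t V A p"
    using assms(2) by (auto simp: path_coalg_def)
  have "is_path s t V A p" if "rstrip t y c p \<noteq> 0" for p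
    using that path[of "pconcat p y"] is_path_pconcat_iff[OF assms(1), of p y]
    by (simp add: rstrip_def split: if_splits)
  then show "rstrip t y c \<in> path_coalg s t V A"
    using finite_support_strips(1)[OF fin] by (auto simp: path_coalg_def)
  have "is_path s t V A p" if "reg_coact t y c p \<noteq> 0" for p
    using that path[of "pconcat y p"] is_path_pconcat_iff[OF assms(1), of y p]
    by (simp add: reg_coact_def split: if_splits)
  then show "reg_coact t y c \<in> path_coalg s t V A"
    using finite_support_strips(2)[OF fin] by (auto simp: path_coalg_def)
qed

lemma ksubspace_path_coalg: "ksubspace (path_coalg s t V A :: ('v,'a,'k::field) lc set)"
  unfolding ksubspace_def
proof (intro conjI ballI allI)
  fix x y :: "('v,'a,'k) lc" assume xy: "x \<in> path_coalg s t V A" "y \<in> path_coalg s t V A"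
  then have "finite ({p. x p \<noteq> 0} \<union> {p. y p \<noteq> 0})" by (simp add: path_coalg_def)
  then have "finite {p. x p + y p \<noteq> 0}" by (rule rev_finite_subset) auto
  moreover have "is_path s t V A p" if "x p + y p \<noteq> 0" for p
    using that xy unfolding path_coalg_def by (cases "x p = 0") (simp_all del: split_paired_All)
  ultimately show "(\<lambda>p. x p + y p) \<in> path_coalg s t V A" by (simp add: path_coalg_def)
next
  fix a and x :: "('v,'a,'k) lc" assume x: "x \<in> path_coalg s t V A"
  then have "finite {p. x p \<noteq> 0}" by (simp add: path_coalg_def)
  then have "finite {p. a * x p \<noteq> 0}" by (rule rev_finite_subset) auto
  then show "(\<lambda>p. a * x p) \<in> path_coalg s t V A" using x by (simp add: path_coalg_def)
qed (simp add: path_coalg_def)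

lemma rstrip_outside:
  assumes "is_quiver s t V A" "c \<in> path_coalg s t V A" "ptgt t y \<notin> V"
  shows "rstrip t y c = (\<lambda>_. 0)"
proof
  fix x
  have "\<not> is_path s t V A (pconcat x y)" if "ptgt t x = psrc y"
    using assms(3) is_path_ptgt[OF assms(1)] by (metis that ptgt_pconcat)
  then show "rstrip t y c x = 0"
    using assms(2) unfolding rstrip_def path_coalg_def by (metis (mono_tags, lifting) mem_Collect_eq)
qed

section \<open>Generated subcoalgebras\<close>

lemma ksubspace_Inter: "(\<And>E. E \<in> X \<Longrightarrow> ksubspace E) \<Longrightarrow> ksubspace (\<Inter>X)"
  unfolding ksubspace_def by simp

text \<open>Closure under strips passes to intersections at once, which is not evident for the
  tensor condition. The subcoalgebra \<open>D\<close> keeps the intersected family nonempty and so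
  the result inside the path coalgebra.\<close>

lemma subcoalg_gen_subcoalg:
  assumes "subcoalg s t V A D" "S \<subseteq> D"
  shows "subcoalg s t V A (gen_subcoalg s t V A S)"
proof -
  define X where "X = {E. subcoalg s t V A E \<and> S \<subseteq> E}"
  have X: "ksubspace E" "c \<in> E \<Longrightarrow> reg_coact t x c \<in> E" "c \<in> E \<Longrightarrow> rstrip t x c \<in> E"
    if "E \<in> X" for E c x
    using that subcoalgD[of s t V A E] by (simp_all add: X_def)
  have "ksubspace (\<Inter>X)" using X(1) by (rule ksubspace_Inter)
  moreover have "D \<in> X" using assms by (simp add: X_def)
  then have "\<Inter>X \<subseteq> path_coalg s t V A" by (rule Inter_lower[THEN order_trans]) (rule subcoalgD(2)[OF assms(1)])
  moreover have "reg_coact t x c \<in> \<Inter>X" "rstrip t x c \<in> \<Inter>X" if c: "c \<in> \<Inter>X" for c x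
    by (rule InterI, rule X, assumption, rule InterD[OF c], assumption)+
  ultimately have "subcoalg s t V A (\<Inter>X)" unfolding subcoalg_iff_strips by simp
  then show ?thesis unfolding gen_subcoalg_def X_def .
qed

section \<open>Independent generating sets of right coideals\<close>

lemma gen_rcoideal_subset: "right_coideal t D I \<Longrightarrow> x \<in> I \<Longrightarrow> gen_rcoideal t D x \<subseteq> I"
  by (auto simp: gen_rcoideal_def)

text \<open>A generating set of minimal cardinality is independent.\<close>

lemma ex_independent_generators:
  assumes "finite G" "G \<subseteq> multipaths s t V A C"
  obtains F where "finite F" "independent s t V A C F" "\<And>I. right_coideal t C I \<Longrightarrow> F \<subseteq> I \<Longrightarrow> G \<subseteq> I"
proof -
  define P where "P = (\<lambda>F. finite F \<and> F \<subseteq> multipaths s t V A C \<and> (\<forall>I. right_coideal t C I \<longrightarrow> F \<subseteq> I \<longrightarrow> G \<subseteq> I))"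
  have "P G" using assms by (simp add: P_def)
  then obtain F where F: "P F" and min: "\<And>F'. P F' \<Longrightarrow> card F \<le> card F'"
    using ex_has_least_nat[of P G card] by blast
  have finF: "finite F" and FM: "F \<subseteq> multipaths s t V A C"
    and gen: "\<And>I. right_coideal t C I \<Longrightarrow> F \<subseteq> I \<Longrightarrow> G \<subseteq> I"
    using F by (auto simp: P_def)
  \<comment> \<open>An \<open>f\<close> lying in every right coideal that contains the rest of
    \<open>F\<close> could be dropped, against minimality. Both halves of independence are refuted
    through this.\<close>
  have irred: False if f: "f \<in> F" and I: "\<And>I. right_coideal t C I \<Longrightarrow> F - {f} \<subseteq> I \<Longrightarrow> f \<in> I" for f
  proof -
    have "G \<subseteq> I" if "right_coideal t C I" "F - {f} \<subseteq> I" for I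
      using gen[OF that(1)] I[OF that] that(2) by blast
    then have "P (F - {f})" using finF FM by (auto simp: P_def)
    from min[OF this] show False using f finF by (meson card_Diff1_less leD)
  qed
  have "lin_indep F"
    unfolding lin_indep_def
  proof (intro allI impI ballI, rule ccontr)
    fix S u f
    assume S: "finite S \<and> S \<subseteq> F \<and> (\<forall>p. (\<Sum>f\<in>S. u f * f p) = 0)" and f: "f \<in> S" and uf: "u f \<noteq> 0"
    \<comment> \<open>A nontrivial linear relation is solved for \<open>f\<close>, so
      \<open>f\<close> lies in every subspace containing the other elements.\<close>
    have eq: "f = (\<lambda>p. \<Sum>g\<in>S - {f}. (- u g / u f) * g p)"
    proof
      fix p
      have "u f * f p + (\<Sum>g\<in>S - {f}. u g * g p) = 0"
        using S f by (metis (no_types, lifting) sum.remove)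
      then have "f p = - (\<Sum>g\<in>S - {f}. u g * g p) / u f" using uf by (simp add: field_simps eq_neg_iff_add_eq_0)
      also have "\<dots> = (\<Sum>g\<in>S - {f}. (- u g / u f) * g p)"
        by (simp add: sum_divide_distrib sum_negf)
      finally show "f p = (\<Sum>g\<in>S - {f}. (- u g / u f) * g p)" .
    qed
    show False
    proof (rule irred)
      show "f \<in> F" using S f by blast
      fix I assume I: "right_coideal t C I" "F - {f} \<subseteq> I"
      have "(\<lambda>p. \<Sum>g\<in>S - {f}. (- u g / u f) * g p) \<in> I"
        using I S by (intro ksubspace_sum) (auto simp: right_coideal_def)
      then show "f \<in> I" using eq by simp
    qed
  qed
  moreover have "gen_rcoideal t C x \<inter> F = {x}" if x: "x \<in> F" for x
  proof -
    have "p = x" if p: "p \<in> gen_rcoideal t C x" "p \<in> F" for p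
    proof (rule ccontr)
      assume "p \<noteq> x"
      \<comment> \<open>Since \<open>x\<close> differs from \<open>p\<close>, it lies in
        \<open>I\<close>, and the right coideal it generates brings \<open>p\<close> along.\<close>
      then have "p \<in> I" if "right_coideal t C I" "F - {p} \<subseteq> I" for I
        using gen_rcoideal_subset[OF that(1), of x] that(2) p x by blast
      then show False using irred[OF p(2)] by blast
    qed
    moreover have "x \<in> gen_rcoideal t C x" by (simp add: gen_rcoideal_def)
    ultimately show ?thesis using x by blast
  qed
  ultimately have "independent s t V A C F" using FM by (simp add: independent_def)
  then show thesis using that finF gen by blast
qed

text \<open>The annihilator of \<open>L\<close> is a right coideal, since prefix and suffix strips commute.\<close>

lemma right_coideal_lcomb_kernel:
  assumes "subcoalg s t V A C"
  shows "right_coideal t C {c \<in> C. lcomb t L c = (\<lambda>_. 0)}"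
proof (rule right_coidealI[OF assms])
  note C = subcoalgD(1)[OF assms] and strip = subcoalgD(4)[OF assms]
  show "ksubspace {c \<in> C. lcomb t L c = (\<lambda>_. 0)}"
    using ksubspaceD[OF C] by (auto simp: ksubspace_def lcomb_add lcomb_scale)
  show "rstrip t y c \<in> {c \<in> C. lcomb t L c = (\<lambda>_. 0)}" if "c \<in> {c \<in> C. lcomb t L c = (\<lambda>_. 0)}" for c y
    using that strip rstrip_lcomb[of t y L c] by simp
qed blast

section \<open>One step of the tail closure\<close>

text \<open>Only the cut just before the last arrow can contribute. The common target
  \<open>v\<close> makes the source recorded in the basis path agree with the end of the remaining
  path.\<close>

lemma cmul_arrow:
  assumes "\<And>z. p z \<noteq> 0 \<Longrightarrow> ptgt t z = v"
  shows "cmul t p (pbasis (v, [a])) x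
    = (if snd x \<noteq> [] \<and> last (snd x) = a then p (fst x, butlast (snd x)) else 0)"
proof (cases "snd x" rule: rev_cases)
  case Nil
  then show ?thesis by (simp add: cmul_def pbasis_def)
next
  case (snoc ys b)
  have drop: "drop i (ys @ [b]) = [a] \<longleftrightarrow> i = length ys \<and> b = a" if "i \<le> Suc (length ys)" for i
    using that by (cases "i < length ys"; cases "i = length ys") (auto dest: arg_cong[of _ _ length])
  have "cmul t p (pbasis (v, [a])) x
    = (\<Sum>i\<in>{..Suc (length ys)}. if i = length ys then (if b = a then p (fst x, ys) else 0) else 0)"
    unfolding cmul_def snoc
  proof (intro sum.cong)
    fix i assume "i \<in> {..Suc (length ys)}"
    then have i: "i \<le> Suc (length ys)" by simp
    show "p (fst x, take i (ys @ [b])) * pbasis (v, [a]) (ptgt t (fst x, take i (ys @ [b])), drop i (ys @ [b]))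
      = (if i = length ys then (if b = a then p (fst x, ys) else 0) else 0)"
      using drop[OF i] assms[of "(fst x, ys)"] by (auto simp: pbasis_def)
  qed simp
  also have "\<dots> = (if b = a then p (fst x, ys) else 0)" by simp
  finally show ?thesis using snoc by simp
qed

text \<open>The choice made in \<open>mtgt\<close> is immaterial, as all paths in the support share
  their target.\<close>

lemma multipath_ptgt: "multipath s t V A p \<Longrightarrow> p z \<noteq> 0 \<Longrightarrow> ptgt t z = mtgt t p"
  unfolding multipath_def mtgt_def by (metis (mono_tags, lifting) someI_ex)

text \<open>The last conclusion says that the paths of \<open>C'\<close> ending in the new vertex \<open>e\<close> of \<open>F\<close> form the
  left coideal generated by \<open>q\<^sub>F\<close>.\<close>

lemma tail_step:
  fixes C :: "('v,'a,'k::field) lc set"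
  assumes Q: "is_quiver s t V A" and C: "subcoalg s t V A C" and step: "tail_step s t V A C V' A' C'"
  shows "is_quiver s t V' A'" "subcoalg s t V' A' C'" "C \<subseteq> C'" "V \<subseteq> V'"
    and "\<And>c w. c \<in> C' \<Longrightarrow> w \<in> V \<Longrightarrow> rstrip t (w, []) c \<in> C"
    and "\<And>F. finite F \<Longrightarrow> independent s t V A C F \<Longrightarrow> \<exists>e\<in>V'. \<exists>q\<in>C'. rstrip t (e, []) q = q
      \<and> (\<forall>c\<in>C'. \<exists>L. rstrip t (e, []) c = lcomb t L q) \<and> (\<forall>p\<in>F. \<exists>y. rstrip t y q = p)"
proof -
  define FF where "FF = {F. finite F \<and> independent s t V A C F}"
  obtain eV :: "('v,'a,'k) lc set \<Rightarrow> 'v" and eA :: "('v,'a,'k) lc set \<Rightarrow> ('v,'a,'k) lc \<Rightarrow> 'a" where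
    injV: "inj_on eV FF" and freshV: "\<forall>F\<in>FF. eV F \<notin> V"
    and injA: "inj_on (\<lambda>(F,p). eA F p) (Sigma FF (\<lambda>F. F))"
    and arr: "\<forall>F\<in>FF. \<forall>p\<in>F. eA F p \<notin> A \<and> s (eA F p) = mtgt t p \<and> t (eA F p) = eV F"
    and V': "V' = V \<union> eV ` FF" and A': "A' = A \<union> {eA F p | F p. F \<in> FF \<and> p \<in> F}"
    and C': "C' = gen_subcoalg s t V' A'
              (C \<union> {(\<lambda>x. \<Sum>p\<in>F. cmul t p (pbasis (s (eA F p), [eA F p])) x) | F. F \<in> FF})"
    using step unfolding tail_step_def Let_def FF_def by blast
  define q where "q = (\<lambda>F x. \<Sum>p\<in>F. cmul t p (pbasis (s (eA F p), [eA F p])) x)"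
  have C'_q: "C' = gen_subcoalg s t V' A' (C \<union> q ` FF)"
    unfolding C' q_def by (rule arg_cong[where f = "gen_subcoalg s t V' A'"]) blast
  note Csub = subcoalgD(1,2)[OF C] and Cstrip = subcoalgD(3,4)[OF C]
  have mp: "multipath s t V A p" "p \<in> C" if "F \<in> FF" "p \<in> F" for F p
    using that by (auto simp: FF_def independent_def multipaths_def)
  have tgt_p: "ptgt t z = s (eA F p)" if "F \<in> FF" "p \<in> F" "p z \<noteq> 0" for F p z
    using multipath_ptgt[OF mp(1)[OF that(1,2)] that(3)] arr that by simp
  have path_p: "is_path s t V A z" if "F \<in> FF" "p \<in> F" "p z \<noteq> 0" for F p z
    using mp(2)[OF that(1,2)] Csub(2) that(3) unfolding path_coalg_def by blast
  have finF: "finite F" if "F \<in> FF" for F using that by (simp add: FF_def)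
  have q_eq: "q F x = (\<Sum>p\<in>F. if snd x \<noteq> [] \<and> last (snd x) = eA F p then p (fst x, butlast (snd x)) else 0)"
    if F: "F \<in> FF" for F x
    unfolding q_def using tgt_p[OF F] by (intro sum.cong refl cmul_arrow) blast
  \<comment> \<open>The new arrows are pairwise distinct, so a path ending in \<open>eA F p\<close>
    receives a contribution from the summand of \<open>p\<close> alone.\<close>
  have q_snoc: "q F x = p (fst x, butlast (snd x))" if F: "F \<in> FF" "p \<in> F" "snd x \<noteq> []" "last (snd x) = eA F p" for F p x
  proof -
    have "eA F p = eA F p' \<longleftrightarrow> p' = p" if "p' \<in> F" for p'
      using inj_onD[OF injA, of "(F,p)" "(F,p')"] F that by auto
    then have "q F x = (\<Sum>p'\<in>F. if p' = p then p (fst x, butlast (snd x)) else 0)"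
      unfolding q_eq[OF F(1)] using F by (intro sum.cong) auto
    then show ?thesis using F finF by simp
  qed
  have q_nz: "\<exists>p\<in>F. snd x \<noteq> [] \<and> last (snd x) = eA F p \<and> p (fst x, butlast (snd x)) \<noteq> 0"
    if F: "F \<in> FF" and "q F x \<noteq> 0" for F x
  proof (rule ccontr)
    assume *: "\<not> ?thesis"
    have "q F x = 0" unfolding q_eq[OF F]
    proof (intro sum.neutral ballI)
      fix p assume "p \<in> F"
      with * show "(if snd x \<noteq> [] \<and> last (snd x) = eA F p then p (fst x, butlast (snd x)) else 0) = 0"
        by auto
    qed
    with that(2) show False by simp
  qed
  have q_tgt: "ptgt t x = eV F" if F: "F \<in> FF" "q F x \<noteq> 0" for F x
    using q_nz[OF F] arr F(1) by (auto simp: ptgt_def)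
  show VV': "V \<subseteq> V'" using V' by blast
  have AA': "A \<subseteq> A'" using A' by blast
  show Q': "is_quiver s t V' A'"
    unfolding is_quiver_def
  proof
    fix a assume "a \<in> A'"
    then consider "a \<in> A" | F p where "F \<in> FF" "p \<in> F" "a = eA F p" using A' by blast
    then show "s a \<in> V' \<and> t a \<in> V'"
    proof cases
      case 1
      then show ?thesis using Q VV' unfolding is_quiver_def by blast
    next
      case 2
      \<comment> \<open>A multipath is nonzero, so it contains a path of the old quiver; the end of
        that path is the source of the new arrow.\<close>
      obtain z where z: "p z \<noteq> 0" using mp(1)[OF 2(1,2)] unfolding multipath_def by blast
      then have "s a \<in> V"
        using tgt_p[OF 2(1,2) z] is_path_ptgt[OF Q path_p[OF 2(1,2) z]] 2(3) by simp
      then show ?thesis using 2 arr V' by auto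
    qed
  qed
  have q_path: "is_path s t V' A' x" if F: "F \<in> FF" and x: "q F x \<noteq> 0" for F x
  proof -
    obtain p where p: "p \<in> F" "snd x \<noteq> []" "last (snd x) = eA F p" "p (fst x, butlast (snd x)) \<noteq> 0"
      using q_nz[OF F x] by blast
    have x_eq: "x = pconcat (fst x, butlast (snd x)) (s (eA F p), [eA F p])"
      using p by (metis append_butlast_last_id fst_conv pconcat_def prod.collapse snd_conv)
    have "is_path s t V' A' (fst x, butlast (snd x))"
      using path_p[OF F p(1,4)] VV' AA' by (rule is_path_mono)
    moreover have "eA F p \<in> A'" using A' F p(1) by blast
    then have "is_path s t V' A' (s (eA F p), [eA F p])"
      using Q' by (auto simp: is_path_def is_quiver_def)
    moreover have "ptgt t (fst x, butlast (snd x)) = psrc (s (eA F p), [eA F p])"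
      using tgt_p[OF F p(1,4)] by (simp add: psrc_def)
    ultimately show ?thesis using is_path_pconcat_iff[OF Q'] x_eq by metis
  qed
  have q_coalg: "q F \<in> path_coalg s t V' A'" if F: "F \<in> FF" for F
  proof -
    have "finite (\<Union>p\<in>F. (\<lambda>z. (fst z, snd z @ [eA F p])) ` {z. p z \<noteq> 0})"
      using finF[OF F] mp(1)[OF F] by (auto simp: multipath_def path_coalg_def)
    moreover have "{x. q F x \<noteq> 0} \<subseteq> (\<Union>p\<in>F. (\<lambda>z. (fst z, snd z @ [eA F p])) ` {z. p z \<noteq> 0})"
    proof
      fix x assume "x \<in> {x. q F x \<noteq> 0}"
      then obtain p where p: "p \<in> F" "snd x \<noteq> []" "last (snd x) = eA F p" "p (fst x, butlast (snd x)) \<noteq> 0"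
        using q_nz[OF F] by blast
      then have "x = (\<lambda>z. (fst z, snd z @ [eA F p])) (fst x, butlast (snd x))"
        by (metis append_butlast_last_id fst_conv prod.collapse snd_conv)
      then show "x \<in> (\<Union>p\<in>F. (\<lambda>z. (fst z, snd z @ [eA F p])) ` {z. p z \<noteq> 0})" using p by blast
    qed
    ultimately have "finite {x. q F x \<noteq> 0}" by (rule finite_subset[rotated])
    then show ?thesis using q_path[OF F] unfolding path_coalg_def by blast
  qed
  have q_tgt_strip: "rstrip t (w, []) (q F) = (if w = eV F then q F else (\<lambda>_. 0))" if F: "F \<in> FF" for F w
  proof
    fix x
    show "rstrip t (w, []) (q F) x = (if w = eV F then q F else (\<lambda>_. 0)) x"
      using q_tgt[OF F, of x] by (cases "q F x = 0") (auto simp: rstrip_trivial)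
  qed
  have q_strip: "rstrip t y (q F) = rstrip t (fst y, butlast (snd y)) p"
    if F: "F \<in> FF" "p \<in> F" "snd y \<noteq> []" "last (snd y) = eA F p" for F p y
  proof
    fix x
    show "rstrip t y (q F) x = rstrip t (fst y, butlast (snd y)) p x"
      using q_snoc[OF F(1,2), of "pconcat x y"] F(3,4)
      by (simp add: rstrip_def psrc_def pconcat_def butlast_append)
  qed
  have q_strip_arrow: "rstrip t (s (eA F p), [eA F p]) (q F) = p" if F: "F \<in> FF" "p \<in> F" for F p
  proof
    fix x
    show "rstrip t (s (eA F p), [eA F p]) (q F) x = p x"
      using q_strip[OF F, of "(s (eA F p), [eA F p])"] tgt_p[OF F, of x]
      by (cases "p x = 0") (auto simp: rstrip_trivial)
  qed
  have q_strip_other: "rstrip t y (q F) = (\<lambda>_. 0)"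
    if F: "F \<in> FF" "snd y \<noteq> []" "\<And>p. p \<in> F \<Longrightarrow> last (snd y) \<noteq> eA F p" for F y
  proof
    fix x
    have "q F (pconcat x y) = 0"
      using q_nz[OF F(1), of "pconcat x y"] F(2,3) by (auto simp: pconcat_def)
    then show "rstrip t y (q F) x = 0" by (simp add: rstrip_def)
  qed
  \<comment> \<open>\<open>N F\<close> is the left coideal generated by \<open>q F\<close>.\<close>
  define N where "N = (\<lambda>F. {lcomb t L (q F) | L. True})"
  have Nsub: "ksubspace (N F)" for F unfolding N_def by (rule ksubspace_lcombs)
  have N_act: "reg_coact t x c \<in> N F" if "c \<in> N F" for F x c
    using that lcomb_lact unfolding N_def by blast
  \<comment> \<open>An explicit upper bound for \<open>C'\<close>, prescribed target by target:
    \<open>C\<close> at old vertices and \<open>N F\<close> at \<open>eV F\<close>. Showing that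
    \<open>D\<close> is a subcoalgebra containing the generators gives \<open>C'\<close> \<subseteq>
    \<open>D\<close>, from which the statements about components follow.\<close>
  define D where "D = {c \<in> path_coalg s t V' A'. (\<forall>w\<in>V. rstrip t (w, []) c \<in> C) \<and> (\<forall>F\<in>FF. rstrip t (eV F, []) c \<in> N F)}"
  have DI: "c \<in> D" if "c \<in> path_coalg s t V' A'" "\<And>w. w \<in> V \<Longrightarrow> rstrip t (w, []) c \<in> C"
    "\<And>F. F \<in> FF \<Longrightarrow> rstrip t (eV F, []) c \<in> N F" for c
    using that unfolding D_def by blast
  have DD: "c \<in> path_coalg s t V' A'" "\<And>w. w \<in> V \<Longrightarrow> rstrip t (w, []) c \<in> C"
    "\<And>F. F \<in> FF \<Longrightarrow> rstrip t (eV F, []) c \<in> N F" if "c \<in> D" for c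
    using that unfolding D_def by blast+
  have CD: "c \<in> D" if c: "c \<in> C" for c
  proof (rule DI)
    show "c \<in> path_coalg s t V' A'" using c Csub(2) path_coalg_mono[OF VV' AA'] by blast
    show "rstrip t (w, []) c \<in> C" for w by (rule Cstrip(2)[OF c])
    show "rstrip t (eV F, []) c \<in> N F" if "F \<in> FF" for F
      using rstrip_outside[OF Q, of c "(eV F, [])"] freshV that Csub(2) c ksubspaceD(1)[OF Nsub] by auto
  qed
  have qD: "q F \<in> D" if F: "F \<in> FF" for F
  proof (rule DI)
    show "q F \<in> path_coalg s t V' A'" by (rule q_coalg[OF F])
    show "rstrip t (w, []) (q F) \<in> C" if "w \<in> V" for w
      using that freshV F ksubspaceD(1)[OF Csub(1)] by (auto simp: q_tgt_strip)
    show "rstrip t (eV G, []) (q F) \<in> N G" if G: "G \<in> FF" for G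
    proof (cases "F = G")
      case True
      obtain L where "lcomb t L (q F) = q F"
        using ex_lcomb_self q_coalg[OF F] unfolding path_coalg_def by blast
      then have "q F \<in> N F" unfolding N_def by (metis (mono_tags, lifting) mem_Collect_eq)
      then show ?thesis using True q_tgt_strip[OF F, of "eV F"] by simp
    next
      case False
      then have "eV G \<noteq> eV F" using injV F G by (auto dest: inj_onD)
      then show ?thesis using ksubspaceD(1)[OF Nsub] by (simp add: q_tgt_strip[OF F])
    qed
  qed
  have Dsub: "ksubspace D"
    unfolding ksubspace_def
  proof (intro conjI ballI allI)
    show "(\<lambda>_. 0) \<in> D"
      by (rule DI) (simp_all add: ksubspaceD(1)[OF ksubspace_path_coalg] ksubspaceD(1)[OF Csub(1)] ksubspaceD(1)[OF Nsub])
    show "(\<lambda>p. x p + y p) \<in> D" if "x \<in> D" "y \<in> D" for x y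
      by (rule DI; (unfold rstrip_add)?)
        (intro ksubspaceD(2)[OF ksubspace_path_coalg] ksubspaceD(2)[OF Csub(1)] ksubspaceD(2)[OF Nsub] DD that, (assumption+)?)+
    show "(\<lambda>p. a * x p) \<in> D" if "x \<in> D" for a x
      by (rule DI; (unfold rstrip_scale)?)
        (intro ksubspaceD(3)[OF ksubspace_path_coalg] ksubspaceD(3)[OF Csub(1)] ksubspaceD(3)[OF Nsub] DD that, (assumption+)?)+
  qed
  have D_act: "reg_coact t x c \<in> D" if "c \<in> D" for x c
    by (rule DI; (unfold rstrip_reg_coact)?)
      (intro path_coalg_strips(2)[OF Q'] Cstrip(1) N_act DD that, (assumption+)?)+
  have D_lcomb: "lcomb t L c \<in> D" if "c \<in> D" for L c
    using Dsub D_act[OF that] by (rule lcomb_mem)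
  \<comment> \<open>A trivial suffix gives \<open>q F\<close> or 0. A suffix ending in a new arrow
    of \<open>F\<close> leaves a suffix strip of some \<open>p\<close>, which is in
    \<open>C\<close>. Any other suffix gives 0.\<close>
  have q_strip_D: "rstrip t y (q F) \<in> D" if F: "F \<in> FF" for y F
  proof (cases "snd y = []")
    case True
    then obtain w where "y = (w, [])" by (cases y) simp
    then show ?thesis using qD[OF F] ksubspaceD(1)[OF Dsub] by (simp add: q_tgt_strip[OF F])
  next
    case y: False
    show ?thesis
    proof (cases "\<exists>p\<in>F. last (snd y) = eA F p")
      case True
      then obtain p where "p \<in> F" "last (snd y) = eA F p" by blast
      then show ?thesis using q_strip[OF F _ y] CD[OF Cstrip(2)[OF mp(2)[OF F]]] by simp
    next
      case False
      then show ?thesis using q_strip_other[OF F y] ksubspaceD(1)[OF Dsub] by auto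
    qed
  qed
  \<comment> \<open>The target of \<open>y\<close> decides. At an old vertex the strip is in
    \<open>C\<close>; at \<open>eV F\<close> it is a combination of prefix strips of a suffix strip
    of \<open>q F\<close>; outside \<open>V'\<close> it vanishes.\<close>
  have D_rstrip: "rstrip t y c \<in> D" if c: "c \<in> D" for y c
  proof -
    consider "ptgt t y \<in> V" | F where "F \<in> FF" "ptgt t y = eV F" | "ptgt t y \<notin> V'" using V' by blast
    then show ?thesis
    proof cases
      case 1
      then have "rstrip t y (rstrip t (ptgt t y, []) c) \<in> C" by (intro Cstrip(2) DD(2)[OF c])
      then show ?thesis using CD by (simp add: rstrip_rstrip_tgt)
    next
      case 2
      obtain L where L: "rstrip t (ptgt t y, []) c = lcomb t L (q F)"
        using DD(3)[OF c 2(1)] 2(2) unfolding N_def by auto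
      have "rstrip t y c = lcomb t L (rstrip t y (q F))"
        using arg_cong[OF L, of "rstrip t y"] by (simp add: rstrip_rstrip_tgt rstrip_lcomb)
      then show ?thesis using D_lcomb[OF q_strip_D[OF 2(1)]] by simp
    next
      case 3
      then show ?thesis using rstrip_outside[OF Q' DD(1)[OF c]] ksubspaceD(1)[OF Dsub] by simp
    qed
  qed
  have D: "subcoalg s t V' A' D"
    unfolding subcoalg_iff_strips using Dsub DD(1) D_act D_rstrip by blast
  have gens: "C \<union> q ` FF \<subseteq> D" using CD qD by blast
  show "subcoalg s t V' A' C'" unfolding C'_q using D gens by (rule subcoalg_gen_subcoalg)
  have C'D: "C' \<subseteq> D" unfolding C'_q gen_subcoalg_def using D gens by blast
  have gens': "C \<union> q ` FF \<subseteq> C'" unfolding C'_q gen_subcoalg_def by blast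
  then show "C \<subseteq> C'" by blast
  show "rstrip t (w, []) c \<in> C" if "c \<in> C'" "w \<in> V" for c w
    using C'D that DD(2) by blast
  show "\<exists>e\<in>V'. \<exists>q\<in>C'. rstrip t (e, []) q = q
      \<and> (\<forall>c\<in>C'. \<exists>L. rstrip t (e, []) c = lcomb t L q) \<and> (\<forall>p\<in>F. \<exists>y. rstrip t y q = p)"
    if "finite F" "independent s t V A C F" for F
  proof (intro bexI conjI ballI)
    have F: "F \<in> FF" using that by (simp add: FF_def)
    show "eV F \<in> V'" using V' F by blast
    show "q F \<in> C'" using gens' F by blast
    show "rstrip t (eV F, []) (q F) = q F" by (simp add: q_tgt_strip[OF F])
    show "\<exists>L. rstrip t (eV F, []) c = lcomb t L (q F)" if "c \<in> C'" for c
      using DD(3)[of c F] C'D that F unfolding N_def by blast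
    show "\<exists>y. rstrip t y (q F) = p" if "p \<in> F" for p
      using q_strip_arrow[OF F that] by blast
  qed
qed

section \<open>Comodules over the tail closure\<close>

lemma lcomodule_linear:
  assumes "lcomodule t D sc \<rho>"
  shows "\<rho> p (x + y) = \<rho> p x + \<rho> p y" "\<rho> p (sc a x) = sc a (\<rho> p x)" "\<rho> p 0 = 0"
    "\<rho> p (sum f X) = (\<Sum>i\<in>X. \<rho> p (f i))"
    "sc a (x + y) = sc a x + sc a y" "sc (a + b) x = sc a x + sc b x" "sc a (sc b x) = sc (a * b) x" "sc 1 x = x"
    "sc 0 x = 0" "sc a 0 = 0" "sc (-1) x = - x" "sc a (sum g Y) = (\<Sum>i\<in>Y. sc a (g i))"
proof -
  interpret lin: Vector_Spaces.linear sc sc "\<rho> p"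
    using assms unfolding lcomodule_def by blast
  show "\<rho> p (x + y) = \<rho> p x + \<rho> p y" "\<rho> p (sc a x) = sc a (\<rho> p x)" "\<rho> p 0 = 0"
    "\<rho> p (sum f X) = (\<Sum>i\<in>X. \<rho> p (f i))"
    by (simp_all add: lin.add lin.scale lin.zero lin.sum)
  show "sc a (x + y) = sc a x + sc a y" "sc (a + b) x = sc a x + sc b x" "sc a (sc b x) = sc (a * b) x" "sc 1 x = x"
    "sc 0 x = 0" "sc a 0 = 0" "sc (-1) x = - x" "sc a (sum g Y) = (\<Sum>i\<in>Y. sc a (g i))"
    by (simp_all add: lin.vs1.scale_sum_right lin.vs1.scale_right_distrib lin.vs1.scale_left_distrib)
qed

lemma lcomodule_coassoc:
  assumes "lcomodule t D sc \<rho>"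
  shows "\<rho> y (\<rho> x m) = (if ptgt t x = psrc y then \<rho> (pconcat x y) m else 0)"
  using assms unfolding lcomodule_def by blast

lemma mcomb_lscale:
  assumes "lcomodule t D sc \<rho>"
  shows "mcomb sc \<rho> (lscale b L) m = sc b (mcomb sc \<rho> L m)"
  by (induction L) (auto simp: mcomb_Cons lcomodule_linear[OF assms])

lemma mcomb_lact:
  assumes "lcomodule t D sc \<rho>"
  shows "\<rho> y (mcomb sc \<rho> L m) = mcomb sc \<rho> (lact t y L) m"
  by (induction L)
    (auto simp: mcomb_Cons lact_def lcomodule_linear[OF assms] lcomodule_coassoc[OF assms])

text \<open>Composing the projection of \<open>D\<close> onto its paths ending in \<open>e\<close> with \<open>lcomb L q \<mapsto> mcomb L m\<close>.\<close>

lemma comodule_map_of_direct_summand: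
  fixes D :: "('v,'a,'k::field) lc set"
  assumes M: "lcomodule t D' sc \<rho>"
    and act: "\<And>c x. c \<in> D \<Longrightarrow> reg_coact t x c \<in> D"
    and q: "q \<in> D" "rstrip t (e, []) q = q"
    and gen: "\<And>c. c \<in> D \<Longrightarrow> \<exists>L. rstrip t (e, []) c = lcomb t L q"
    and wd: "\<And>L. lcomb t L q = (\<lambda>_. 0) \<Longrightarrow> mcomb sc \<rho> L m = 0"
    and m: "\<rho> (v, []) m = m"
  obtains h where "\<And>c d. c \<in> D \<Longrightarrow> d \<in> D \<Longrightarrow> h (\<lambda>p. c p + d p) = h c + h d"
    and "\<And>a c. c \<in> D \<Longrightarrow> h (\<lambda>p. a * c p) = sc a (h c)"
    and "\<And>x c. c \<in> D \<Longrightarrow> \<rho> x (h c) = h (reg_coact t x c)"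
    and "m \<in> h ` D"
proof -
  note lin = lcomodule_linear[OF M]
  define h where "h = (\<lambda>c. mcomb sc \<rho> (SOME L. rstrip t (e, []) c = lcomb t L q) m)"
  have h: "h c = mcomb sc \<rho> L m" if L: "rstrip t (e, []) c = lcomb t L q" for c L
  proof -
    define K where "K = (SOME L. rstrip t (e, []) c = lcomb t L q)"
    have K: "rstrip t (e, []) c = lcomb t K q" unfolding K_def using L by (rule someI)
    \<comment> \<open>The difference of two lists representing the same element annihilates
      \<open>q\<close>, so by \<open>wd\<close> the value of \<open>h\<close> does not depend on the
      choice.\<close>
    have "lcomb t (L @ lscale (-1) K) q = (\<lambda>_. 0)"
      unfolding lcomb_append lcomb_lscale using L K by simp
    from wd[OF this] have "mcomb sc \<rho> L m - mcomb sc \<rho> K m = 0"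
      unfolding mcomb_append mcomb_lscale[OF M] by (simp add: lin)
    then show ?thesis by (simp add: h_def K_def)
  qed
  show thesis
  proof (rule that)
    fix c d assume "c \<in> D" "d \<in> D"
    then obtain L K where "rstrip t (e, []) c = lcomb t L q" "rstrip t (e, []) d = lcomb t K q"
      using gen by metis
    then show "h (\<lambda>p. c p + d p) = h c + h d"
      using h[of c L] h[of d K] h[of "\<lambda>p. c p + d p" "L @ K"]
      by (simp add: rstrip_add lcomb_append mcomb_append)
  next
    fix a c assume "c \<in> D"
    then obtain L where "rstrip t (e, []) c = lcomb t L q" using gen by metis
    then show "h (\<lambda>p. a * c p) = sc a (h c)"
      using h[of c L] h[of "\<lambda>p. a * c p" "lscale a L"]
      by (simp add: rstrip_scale lcomb_lscale mcomb_lscale[OF M])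
  next
    fix x c assume "c \<in> D"
    then obtain L where "rstrip t (e, []) c = lcomb t L q" using gen by metis
    then show "\<rho> x (h c) = h (reg_coact t x c)"
      using h[of c L] h[of "reg_coact t x c" "lact t x L"]
      by (simp add: rstrip_reg_coact lcomb_lact mcomb_lact[OF M])
  next
    \<comment> \<open>The preimage of \<open>m\<close> is the part of \<open>q\<close> starting at
      \<open>v\<close>: it is represented by a one-element list, which sends \<open>m\<close> to
      \<open>\<rho> (v, []) m\<close>.\<close>
    have "h (reg_coact t (v, []) q) = mcomb sc \<rho> [(1, (v, []))] m"
      by (rule h) (simp add: rstrip_reg_coact q(2) lcomb_Cons)
    then have "h (reg_coact t (v, []) q) = m" by (simp add: mcomb_Cons lin m)
    then show "m \<in> h ` D" using act[OF q(1)] by (metis imageI)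
  qed
qed

text \<open>Together with \<open>lcomb_zero_pairing\<close>: a combination annihilating all
  coefficients of \<open>m\<close> annihilates \<open>m\<close>.\<close>

lemma mcomb_coefficients:
  assumes M: "lcomodule t D sc \<rho>" and coeff: "\<And>p. \<rho> p m = (\<Sum>i<(n::nat). sc (c i p) (w i))"
  shows "mcomb sc \<rho> L m = (\<Sum>i<n. sc (\<Sum>(a,x)\<leftarrow>L. a * c i x) (w i))"
proof (induction L)
  case Nil
  then show ?case by (simp add: lcomodule_linear[OF M])
next
  case (Cons k L)
  obtain a x where k: "k = (a,x)" by (cases k)
  show ?case
    using Cons by (simp add: k mcomb_Cons coeff lcomodule_linear[OF M] sum.distrib)
qed

text \<open>The third conclusion says that later stages add nothing ending at an old vertex. It
  follows by descending one stage at a time, projection onto a target being idempotent.\<close>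

lemma tail_chain:
  fixes Cn :: "nat \<Rightarrow> ('v,'a,'k::field) lc set"
  assumes Q: "is_quiver s t (Vn 0) (An 0)" and C: "subcoalg s t (Vn 0) (An 0) (Cn 0)"
    and step: "\<And>n. tail_step s t (Vn n) (An n) (Cn n) (Vn (Suc n)) (An (Suc n)) (Cn (Suc n))"
  shows "is_quiver s t (Vn n) (An n)" "subcoalg s t (Vn n) (An n) (Cn n)"
    and "\<lbrakk>c \<in> Cn (n + k); w \<in> Vn n\<rbrakk> \<Longrightarrow> rstrip t (w, []) c \<in> Cn n"
    and "m \<le> n \<Longrightarrow> Cn m \<subseteq> Cn n"
proof -
  have QC: "is_quiver s t (Vn n) (An n) \<and> subcoalg s t (Vn n) (An n) (Cn n)" for n
  proof (induction n)
    case 0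
    then show ?case using Q C by simp
  next
    case (Suc n)
    then show ?case using tail_step(1,2)[OF _ _ step[of n]] by simp
  qed
  then show "is_quiver s t (Vn n) (An n)" "subcoalg s t (Vn n) (An n) (Cn n)" for n by simp_all
  note st = tail_step[OF this step]
  have V: "Vn n \<subseteq> Vn (n + k)" for n k
    by (induction k) (use st(4) in \<open>auto intro: subset_trans\<close>)
  show "m \<le> n \<Longrightarrow> Cn m \<subseteq> Cn n" by (rule lift_Suc_mono_le[of Cn]) (rule st(3))
  show "\<lbrakk>c \<in> Cn (n + k); w \<in> Vn n\<rbrakk> \<Longrightarrow> rstrip t (w, []) c \<in> Cn n"
  proof (induction k arbitrary: c)
    case 0
    then show ?case using subcoalgD(4)[OF conjunct2[OF QC]] by simp
  next
    case (Suc k)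
    have "w \<in> Vn (n + k)" using Suc.prems(2) V by blast
    then have "rstrip t (w, []) c \<in> Cn (n + k)" using st(5)[of c "n + k" w] Suc.prems(1) by simp
    from Suc.IH[OF this Suc.prems(2)] show ?case by (simp add: rstrip_tgt_tgt)
  qed
qed

lemma comodule_map_onto_homogeneous:
  fixes TC :: "('v,'a,'k::field) lc set"
  assumes "is_quiver s t V A" "subcoalg s t V A C" "tail_closure s t V A C TV TA TC"
    and M: "lcomodule t TC sc \<rho>" and m: "\<rho> (v, []) m = m"
  obtains h where "\<And>c d. c \<in> TC \<Longrightarrow> d \<in> TC \<Longrightarrow> h (\<lambda>p. c p + d p) = h c + h d"
    and "\<And>a c. c \<in> TC \<Longrightarrow> h (\<lambda>p. a * c p) = sc a (h c)"
    and "\<And>x c. c \<in> TC \<Longrightarrow> \<rho> x (h c) = h (reg_coact t x c)"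
    and "m \<in> h ` TC"
proof -
  note lin = lcomodule_linear[OF M]
  obtain Vn An Cn where 0: "Vn 0 = V" "An 0 = A" "Cn 0 = C"
    and step: "\<And>n. tail_step s t (Vn n) (An n) (Cn n) (Vn (Suc n)) (An (Suc n)) (Cn (Suc n))"
    and TC: "TC = (\<Union>n. Cn n)"
    using assms(3) unfolding tail_closure_def by (elim exE conjE) simp
  have QC0: "is_quiver s t (Vn 0) (An 0)" "subcoalg s t (Vn 0) (An 0) (Cn 0)" using assms(1,2) 0 by simp_all
  note chain = tail_chain[OF QC0 step]
  note st = tail_step[OF chain(1,2) step]
  have "\<exists>(n::nat) c w. (\<forall>i<n. c i \<in> TC) \<and> (\<forall>p. \<rho> p m = (\<Sum>i<n. sc (c i p) (w i)))"
    using M unfolding lcomodule_def by blast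
  then obtain n :: nat and c w where c: "\<And>i. i < n \<Longrightarrow> c i \<in> TC"
    and coeff: "\<And>p. \<rho> p m = (\<Sum>i<n. sc (c i p) (w i))"
    by blast
  \<comment> \<open>Restricting the coefficients to paths from \<open>v\<close> leaves the coaction
    of \<open>m\<close> unchanged, because \<open>\<rho> p m = \<rho> p (\<rho> (v, []) m)\<close>
    vanishes for other sources.\<close>
  define c' where "c' = (\<lambda>i. reg_coact t (v, []) (c i))"
  have coeff': "\<rho> p m = (\<Sum>i<n. sc (c' i p) (w i))" for p
  proof (cases "psrc p = v")
    case True
    then show ?thesis by (simp add: coeff c'_def reg_coact_def pconcat_trivial_left)
  next
    case False
    then have "\<rho> p (\<rho> (v, []) m) = 0" by (simp add: lcomodule_coassoc[OF M])
    then show ?thesis using False by (auto simp: m c'_def reg_coact_def lin)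
  qed
  have "\<exists>N. \<forall>i<j. c i \<in> Cn N" if "j \<le> n" for j
    using that
  proof (induction j)
    case (Suc j)
    then obtain N where N: "\<forall>i<j. c i \<in> Cn N" by auto
    obtain N' where N': "c j \<in> Cn N'" using c[of j] Suc.prems TC by auto
    have "c i \<in> Cn (max N N')" if "i < Suc j" for i
      using that N N' chain(4)[of N "max N N'"] chain(4)[of N' "max N N'"] by (auto simp: less_Suc_eq)
    then show ?case by auto
  qed simp
  then obtain N where N: "\<And>i. i < n \<Longrightarrow> c i \<in> Cn N" by auto
  note sN = subcoalgD[OF chain(2)[of N]]
  have c'N: "c' i \<in> Cn N" if "i < n" for i unfolding c'_def using sN(3)[OF N[OF that]] .
  \<comment> \<open>The coefficients already have the single source \<open>v\<close>; splitting them
    by target yields multipaths.\<close>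
  define G where "G = {rstrip t (u, []) (c' i) | i u. i < n \<and> u \<in> ptgt t ` {p. c' i p \<noteq> 0}}"
  have fin_c': "finite {p. c' i p \<noteq> 0}" if "i < n" for i
    using c'N[OF that] sN(2) unfolding path_coalg_def by auto
  have "finite G"
  proof -
    have "G = (\<Union>i\<in>{..<n}. (\<lambda>u. rstrip t (u, []) (c' i)) ` ptgt t ` {p. c' i p \<noteq> 0})"
      unfolding G_def by auto
    then show ?thesis using fin_c' by simp
  qed
  moreover have "G \<subseteq> multipaths s t (Vn N) (An N) (Cn N)"
  proof
    fix g assume "g \<in> G"
    then obtain i p where i: "i < n" and p: "c' i p \<noteq> 0" and g: "g = rstrip t (ptgt t p, []) (c' i)"
      unfolding G_def by auto
    have gN: "g \<in> Cn N" unfolding g using sN(4)[OF c'N[OF i]] .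
    have "g p \<noteq> 0" using p by (simp add: g rstrip_trivial)
    then have "g \<noteq> (\<lambda>_. 0)" by auto
    moreover have "psrc x = v \<and> ptgt t x = ptgt t p" if "g x \<noteq> 0" for x
      using that by (auto simp: g rstrip_trivial c'_def reg_coact_def split: if_splits)
    ultimately show "g \<in> multipaths s t (Vn N) (An N) (Cn N)"
      using gN sN(2) by (auto simp: multipaths_def multipath_def)
  qed
  ultimately obtain F where F: "finite F" "independent s t (Vn N) (An N) (Cn N) F"
    and genF: "\<And>I. right_coideal t (Cn N) I \<Longrightarrow> F \<subseteq> I \<Longrightarrow> G \<subseteq> I"
    by (rule ex_independent_generators) blast
  from st(6)[OF F] obtain e q where e: "e \<in> Vn (Suc N)" and q: "q \<in> Cn (Suc N)" "rstrip t (e, []) q = q"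
    and gen: "\<And>c. c \<in> Cn (Suc N) \<Longrightarrow> \<exists>L. rstrip t (e, []) c = lcomb t L q"
    and qF: "\<And>p. p \<in> F \<Longrightarrow> \<exists>y. rstrip t y q = p"
    by metis
  show thesis
  proof (rule comodule_map_of_direct_summand[OF M _ _ q(2) _ _ m])
    show "reg_coact t x c \<in> TC" if "c \<in> TC" for c x
      using that subcoalgD(3)[OF chain(2)] unfolding TC by blast
    show "q \<in> TC" using q(1) TC by blast
    \<comment> \<open>Since \<open>e\<close> is a vertex of stage \<open>Suc N\<close>, the
      component at \<open>e\<close> of any element of \<open>TC\<close> lies in that stage, where it
      is a combination of prefix strips of \<open>q\<close>.\<close>
    show "\<exists>L. rstrip t (e, []) c = lcomb t L q" if c: "c \<in> TC" for c
    proof -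
      obtain k where "c \<in> Cn k" using c TC by blast
      then have "c \<in> Cn (Suc N + k)" using chain(4)[of k "Suc N + k"] by auto
      from gen[OF chain(3)[OF this e]] show ?thesis by (simp add: rstrip_tgt_tgt)
    qed
    \<comment> \<open>Each \<open>p\<close> in \<open>F\<close> is a suffix strip of
      \<open>q\<close>, hence annihilated by \<open>L\<close>. The annihilator of \<open>L\<close>
      is a right coideal, so it contains \<open>G\<close>, then each \<open>c' i\<close> target by
      target, and the pairing with \<open>L\<close> vanishes.\<close>
    show "mcomb sc \<rho> L m = 0" if L: "lcomb t L q = (\<lambda>_. 0)" for L
    proof -
      have "lcomb t L p = (\<lambda>_. 0)" if "p \<in> F" for p
        using qF[OF that] rstrip_lcomb[of t _ L q] L by auto
      moreover have "F \<subseteq> Cn N" using F(2) by (auto simp: independent_def multipaths_def)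
      ultimately have "G \<subseteq> {c \<in> Cn N. lcomb t L c = (\<lambda>_. 0)}"
        by (intro genF right_coideal_lcomb_kernel[OF chain(2)]) auto
      then have G0: "lcomb t L g = (\<lambda>_. 0)" if "g \<in> G" for g using that by auto
      have "(\<Sum>(a,x)\<leftarrow>L. a * c' i x) = 0" if i: "i < n" for i
      proof (rule lcomb_zero_pairing[of t], rule ext)
        fix y
        have "lcomb t L (rstrip t (ptgt t y, []) (c' i)) = (\<lambda>_. 0)"
        proof (cases "ptgt t y \<in> ptgt t ` {p. c' i p \<noteq> 0}")
          case True
          then show ?thesis using i by (intro G0) (auto simp: G_def)
        next
          case False
          then have "ptgt t x = ptgt t y \<Longrightarrow> c' i x = 0" for x by (metis (mono_tags) image_eqI mem_Collect_eq)
          then have "rstrip t (ptgt t y, []) (c' i) x = 0" for x by (simp add: rstrip_trivial)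
          then have "rstrip t (ptgt t y, []) (c' i) = (\<lambda>_. 0)" by (rule ext)
          then show ?thesis by simp
        qed
        then have "rstrip t (ptgt t y, []) (lcomb t L (c' i)) y = 0" by (simp add: rstrip_lcomb)
        then show "lcomb t L (c' i) y = 0" by (simp add: rstrip_trivial)
      qed
      then show ?thesis by (simp add: mcomb_coefficients[OF M coeff'] lin)
    qed
  qed (rule that)
qed

section \<open>Assembling the epimorphism from homogeneous elements\<close>

theorem theorem4p27:
  fixes s t :: "'a \<Rightarrow> 'v" and V TV :: "'v set" and A TA :: "'a set"
    and C TC :: "('v,'a,'k::field) lc set"
    and sc :: "'k \<Rightarrow> 'm::ab_group_add \<Rightarrow> 'm" and \<rho> :: "('v,'a) path \<Rightarrow> 'm \<Rightarrow> 'm"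
  assumes "is_quiver s t V A"
    and "admissible s t V A C"
    and "tail_closure s t V A C TV TA TC"
    and "lcomodule t TC sc \<rho>"
  shows "\<exists>(I :: (nat \<times> 'm) set) f. comod_epi_from_sum t TC I sc \<rho> f"
proof -
  note M = assms(4)
  note lin = lcomodule_linear[OF M]
  have C: "subcoalg s t V A C" using assms(2) by (simp add: admissible_def)
  define H where "H = {m. \<exists>v. \<rho> (v, []) m = m}"
  define P where "P = (\<lambda>m h. (\<forall>c\<in>TC. \<forall>d\<in>TC. h (\<lambda>p. c p + d p) = h c + h d)
      \<and> (\<forall>a. \<forall>c\<in>TC. h (\<lambda>p. a * c p) = sc a (h c))
      \<and> (\<forall>x. \<forall>c\<in>TC. \<rho> x (h c) = h (reg_coact t x c)) \<and> m \<in> h ` TC)"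
  have "\<exists>h. P m h" if m: "m \<in> H" for m
  proof -
    from m obtain v where v: "\<rho> (v, []) m = m" by (auto simp: H_def)
    show ?thesis
    proof (rule comodule_map_onto_homogeneous[OF assms(1) C assms(3) M v])
      fix h
      assume "\<And>c d. c \<in> TC \<Longrightarrow> d \<in> TC \<Longrightarrow> h (\<lambda>p. c p + d p) = h c + h d"
        "\<And>a c. c \<in> TC \<Longrightarrow> h (\<lambda>p. a * c p) = sc a (h c)"
        "\<And>x c. c \<in> TC \<Longrightarrow> \<rho> x (h c) = h (reg_coact t x c)" "m \<in> h ` TC"
      then have "P m h" unfolding P_def by (intro conjI ballI allI)
      then show ?thesis by (rule exI[of _ h])
    qed
  qed
  then obtain h where "\<forall>m\<in>H. P m (h m)" by (rule bchoice[OF ballI, THEN exE])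
  then have P: "P m (h m)" if "m \<in> H" for m using that by (rule bspec)
  note add = P[unfolded P_def, THEN conjunct1, rule_format]
    and scale = P[unfolded P_def, THEN conjunct2, THEN conjunct1, rule_format]
    and act = P[unfolded P_def, THEN conjunct2, THEN conjunct2, THEN conjunct1, rule_format]
    and onto = P[unfolded P_def, THEN conjunct2, THEN conjunct2, THEN conjunct2]
  have zero: "h m (\<lambda>_. 0) = 0" if m: "m \<in> H" for m
  proof -
    obtain c where "c \<in> TC" using onto[OF m] by blast
    from scale[OF m this, of 0] show ?thesis by (simp add: lin)
  qed
  \<comment> \<open>One copy of \<open>TC\<close> per homogeneous element; the first coordinate is
    fixed at 0, so the index is determined by that element.\<close>
  define I :: "(nat \<times> 'm) set" where "I = {0} \<times> H"
  define f where "f = (\<lambda>g. \<Sum>i\<in>{i \<in> I. g i \<noteq> (\<lambda>_. 0)}. h (snd i) (g i))"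
  \<comment> \<open>The sum may run over any larger finite set of indices, which is needed because
    supports can shrink under addition, scaling and stripping.\<close>
  have f: "f g = (\<Sum>i\<in>J. h (snd i) (g i))" if "finite J" "J \<subseteq> I" "{i. g i \<noteq> (\<lambda>_. 0)} \<subseteq> J" for g J
    unfolding f_def
  proof (rule sum.mono_neutral_left)
    show "\<forall>i\<in>J - {i \<in> I. g i \<noteq> (\<lambda>_. 0)}. h (snd i) (g i) = 0"
      using that(2) zero by (auto simp: I_def)
  qed (use that in auto)
  have supp: "finite {i. g i \<noteq> (\<lambda>_. 0)}" "{i. g i \<noteq> (\<lambda>_. 0)} \<subseteq> I" "\<And>i. i \<in> I \<Longrightarrow> g i \<in> TC"
    if "g \<in> dsum TC I" for g
    using that unfolding dsum_def by blast+
  have IH: "snd i \<in> H" if "i \<in> I" for i using that by (auto simp: I_def)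
  obtain Vn An Cn where 0: "Vn 0 = V" "An 0 = A" "Cn 0 = C"
    and step: "\<And>n. tail_step s t (Vn n) (An n) (Cn n) (Vn (Suc n)) (An (Suc n)) (Cn (Suc n))"
    and TC: "TC = (\<Union>n. Cn n)"
    using assms(3) unfolding tail_closure_def by (elim exE conjE) simp
  have QC0: "is_quiver s t (Vn 0) (An 0)" "subcoalg s t (Vn 0) (An 0) (Cn 0)" using assms(1) C 0 by simp_all
  note chain = tail_chain[OF QC0 step]
  have TC0: "(\<lambda>_. 0) \<in> TC" using ksubspaceD(1)[OF subcoalgD(1)[OF chain(2)]] TC by blast
  \<comment> \<open>Two elements of the increasing union lie in a common stage.\<close>
  have TC_add: "(\<lambda>p. c p + d p) \<in> TC" if cd: "c \<in> TC" "d \<in> TC" for c d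
  proof -
    obtain j k where "c \<in> Cn j" "d \<in> Cn k" using cd TC by blast
    then have "c \<in> Cn (max j k)" "d \<in> Cn (max j k)"
      using chain(4)[of j "max j k"] chain(4)[of k "max j k"] by auto
    from ksubspaceD(2)[OF subcoalgD(1)[OF chain(2)] this] show ?thesis using TC by blast
  qed
  have f_add: "f (\<lambda>i p. g i p + k i p) = f g + f k" if g: "g \<in> dsum TC I" and k: "k \<in> dsum TC I" for g k
  proof -
    let ?J = "{i. g i \<noteq> (\<lambda>_. 0)} \<union> {i. k i \<noteq> (\<lambda>_. 0)}"
    have J: "finite ?J" "?J \<subseteq> I" using supp[OF g] supp[OF k] by simp_all
    have "f (\<lambda>i p. g i p + k i p) = (\<Sum>i\<in>?J. h (snd i) (\<lambda>p. g i p + k i p))"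
      by (rule f[OF J]) auto
    also have "\<dots> = (\<Sum>i\<in>?J. h (snd i) (g i) + h (snd i) (k i))"
      using J(2) supp(3)[OF g] supp(3)[OF k] IH by (intro sum.cong refl add) blast+
    also have "\<dots> = f g + f k"
      by (simp add: sum.distrib f[OF J, of g] f[OF J, of k])
    finally show ?thesis .
  qed
  have dsum_add: "(\<lambda>i p. g i p + k i p) \<in> dsum TC I" if g: "g \<in> dsum TC I" and k: "k \<in> dsum TC I" for g k
  proof -
    have "finite {i. (\<lambda>p. g i p + k i p) \<noteq> (\<lambda>_. 0)}"
      by (rule finite_subset[of _ "{i. g i \<noteq> (\<lambda>_. 0)} \<union> {i. k i \<noteq> (\<lambda>_. 0)}"]) (use supp(1)[OF g] supp(1)[OF k] in auto)
    then show ?thesis using g k TC_add by (simp add: dsum_def)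
  qed
  have f_scale: "f (\<lambda>i p. a * g i p) = sc a (f g)" if g: "g \<in> dsum TC I" for a g
  proof -
    let ?J = "{i. g i \<noteq> (\<lambda>_. 0)}"
    have "f (\<lambda>i p. a * g i p) = (\<Sum>i\<in>?J. h (snd i) (\<lambda>p. a * g i p))"
      by (rule f[OF supp(1,2)[OF g]]) auto
    also have "\<dots> = (\<Sum>i\<in>?J. sc a (h (snd i) (g i)))"
      using supp(2,3)[OF g] IH by (intro sum.cong refl scale) blast+
    also have "\<dots> = sc a (\<Sum>i\<in>?J. h (snd i) (g i))"
      by (simp add: lin)
    also have "\<dots> = sc a (f g)" by (simp add: f[OF supp(1,2)[OF g]])
    finally show ?thesis .
  qed
  have f_act: "\<rho> x (f g) = f (\<lambda>i. reg_coact t x (g i))" if g: "g \<in> dsum TC I" for x g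
  proof -
    let ?J = "{i. g i \<noteq> (\<lambda>_. 0)}"
    have "\<rho> x (f g) = (\<Sum>i\<in>?J. \<rho> x (h (snd i) (g i)))"
      by (simp add: f[OF supp(1,2)[OF g]] lin)
    also have "\<dots> = (\<Sum>i\<in>?J. h (snd i) (reg_coact t x (g i)))"
      using supp(2,3)[OF g] IH by (intro sum.cong refl act) blast+
    also have "\<dots> = f (\<lambda>i. reg_coact t x (g i))"
      by (rule f[OF supp(1,2)[OF g], symmetric]) auto
    finally show ?thesis .
  qed
  have f_homogeneous: "m \<in> f ` dsum TC I" if m: "m \<in> H" for m
  proof -
    obtain c where c: "c \<in> TC" "h m c = m" using onto[OF m] by (metis imageE)
    define g where "g = (\<lambda>i. if i = (0::nat, m) then c else (\<lambda>_. 0))"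
    have "{i. g i \<noteq> (\<lambda>_. 0)} \<subseteq> {(0, m)}" by (auto simp: g_def)
    moreover have "(0, m) \<in> I" using m by (simp add: I_def)
    ultimately have "g \<in> dsum TC I" "f g = m"
      using c TC0 f[of "{(0, m)}" g] by (auto simp: dsum_def g_def intro: finite_subset)
    then show ?thesis by blast
  qed
  have f_zero: "0 \<in> f ` dsum TC I"
    by (rule image_eqI[of _ _ "\<lambda>_ _. 0"]) (auto simp: f_def dsum_def TC0)
  have "m \<in> f ` dsum TC I" for m
  proof -
    \<comment> \<open>Each \<open>\<rho> (v, []) m\<close> is homogeneous, since coassociativity
      makes this projection idempotent. For infinite \<open>W\<close> the sum is 0 by convention.
      The counit axiom then gives \<open>m\<close> itself.\<close>
    have "(\<Sum>v\<in>W. \<rho> (v, []) m) \<in> f ` dsum TC I" for W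
    proof (induction W rule: infinite_finite_induct)
      case (insert v W)
      have "\<rho> (v, []) m \<in> f ` dsum TC I"
        by (rule f_homogeneous) (auto simp: H_def lcomodule_coassoc[OF M])
      then show ?case using insert f_add dsum_add by (smt (verit) image_iff sum.insert)
    qed (simp_all add: f_zero)
    moreover have "(\<Sum>v\<in>{v. \<rho> (v, []) m \<noteq> 0}. \<rho> (v, []) m) = m"
      using M unfolding lcomodule_def by blast
    ultimately show ?thesis by metis
  qed
  then have "f ` dsum TC I = UNIV" by blast
  then have "comod_epi_from_sum t TC I sc \<rho> f"
    unfolding comod_epi_from_sum_def using f_add f_scale f_act by blast
  then show ?thesis by blast
qed

end
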